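(* Let $\mathfrak g=\mathfrak{sp}_{2n}$ and, for $1\le k\le n$, let $\Delta_{2k}\in\mathcal S^{2k}(\mathfrak g)^{\mathfrak g}$ be the sum of the principal $(2k\times2k)$-minors of the matrix $(F_{ij})$. Then, for $0\le r<k\le n$, $$\mathsf m_{2r+1}(\Delta_{2k})=\frac{(2k-2r)!\,(2r)!}{(2k)!}\binom{2n-2k+2r+1}{2r}\,\Delta_{2k-2r}.$$
   Context: $\mathfrak{sp}_{2n}\subset\mathfrak{gl}_{2n}$ is the linear span of $F_{ij}=E_{ij}-\epsilon_i\epsilon_jE_{j'i'}$, $i,j\in\{1,\dots,2n\}$, where $i'=2n-i+1$, $\epsilon_i=1$ for $i\le n$ and $\epsilon_i=-1$ for $i>n$. Minors of the matrix $(F_{ij})$ are computed in the commutative algebra $\mathcal S(\mathfrak{sp}_{2n})$. Maps $\mathsf m_{2r+1}$: embed $\mathcal S^m(\mathfrak g)$ in $\mathfrak g^{\otimes m}$ via the symmetrisation $\varpi(y_1\cdots y_m)=\frac1{m!}\sum_{\sigma\in S_m}y_{\sigma(1)}\otimes\dots\otimes y_{\sigma(m)}$. For $2r+1\le m$, $\mathsf m_{2r+1}$ is the restriction to $\mathcal S^m(\mathfrak g)$ of the map $\mathfrak g^{\otimes m}\to\mathfrak{gl}(\mathfrak g)\otimes\mathfrak g^{\otimes(m-2r-1)}$, $y_1\otimes\dots\otimes y_m\mapsto\operatorname{ad}(y_1)\cdots\operatorname{ad}(y_{2r+1})\otimes y_{2r+2}\otimes\dots\otimes y_m$; the image lies in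 $\mathfrak{so}(\mathfrak g)\otimes\mathfrak g^{\otimes(m-2r-1)}$. One regards $\mathfrak g\subset\mathfrak{so}(\mathfrak g)$ via $\operatorname{ad}$, and $\mathcal S^{m-2r}(\mathfrak g)\subset\mathfrak g^{\otimes(m-2r)}=\mathfrak g\otimes\mathfrak g^{\otimes(m-2r-1)}\subset\mathfrak{so}(\mathfrak g)\otimes\mathfrak g^{\otimes(m-2r-1)}$ via $\varpi$; the displayed equality is understood in this sense. *)

theory Defs
  imports
    "Jordan_Normal_Form.Determinant"
    "Jordan_Normal_Form.DL_Submatrix"
    "HOL-Library.Poly_Mapping"
    "HOL-Combinatorics.Permutations"
begin

(* Matrix rows and columns are numbered 0, ..., 2n-1, so the index i of the literature is i+1 here.
   The ground field is an arbitrary field 'a of characteristic 0. *)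

subsection \<open>The Lie algebra sp(2n)\<close>

type_synonym pos = "nat \<times> nat"

definition E_mat :: "nat \<Rightarrow> pos \<Rightarrow> 'a::field_char_0 mat" where
  "E_mat N p = mat N N (\<lambda>q. if q = p then 1 else 0)"

(* i' = 2n - i + 1 for 1-based indices *)
definition prime_idx :: "nat \<Rightarrow> nat \<Rightarrow> nat" where
  "prime_idx n i = 2 * n - 1 - i"

definition eps :: "nat \<Rightarrow> nat \<Rightarrow> 'a::field_char_0" where
  "eps n i = (if i < n then 1 else -1)"

definition F_elt :: "nat \<Rightarrow> nat \<Rightarrow> nat \<Rightarrow> 'a::field_char_0 mat" where
  "F_elt n i j = E_mat (2*n) (i, j)
     - (eps n i * eps n j) \<cdot>\<^sub>m E_mat (2*n) (prime_idx n j, prime_idx n i)"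

(* The linear span of the matrices F_elt n i j. *)
definition sp :: "nat \<Rightarrow> 'a::field_char_0 mat set" where
  "sp n = {A. \<exists>c. A = mat (2*n) (2*n) (\<lambda>p. \<Sum>i<2*n. \<Sum>j<2*n. c i j * F_elt n i j $$ p)}"

definition ad :: "'a::field_char_0 mat \<Rightarrow> 'a mat \<Rightarrow> 'a mat" where
  "ad y x = y * x - x * y"

subsection \<open>The symmetric algebra and the minors\<close>

(* The symmetric algebra of gl(N) is the polynomial ring in the matrix units, i.e. the algebra of
   the free commutative monoid on the matrix positions.  For g = sp(2n) inside gl(2n), S(g) is the
   subalgebra generated by the linear forms sym_of (2*n) y, y in g. *)
type_synonym 'a sym_alg = "pos multiset \<Rightarrow>\<^sub>0 'a"

definition sym_of :: "nat \<Rightarrow> 'a::field_char_0 mat \<Rightarrow> 'a sym_alg" where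
  "sym_of N y = (\<Sum>p \<in> {..<N} \<times> {..<N}. Poly_Mapping.single {#p#} (y $$ p))"

definition F_matrix :: "nat \<Rightarrow> 'a::field_char_0 sym_alg mat" where
  "F_matrix n = mat (2*n) (2*n) (\<lambda>(i, j). sym_of (2*n) (F_elt n i j))"

definition Delta :: "nat \<Rightarrow> nat \<Rightarrow> 'a::field_char_0 sym_alg" where
  "Delta n d = (\<Sum>I | I \<subseteq> {..<2*n} \<and> card I = d. det (submatrix (F_matrix n) I I))"

subsection \<open>Tensors, symmetrisation and the maps m\<close>

(* A tensor over gl(N) is given by its coefficients: T w is the coefficient of
   E_(w!0) \<otimes> ... \<otimes> E_(w!(m-1)), where m = length w. Tensor powers of g = sp(2n) are subspaces
   of those of gl(2n). *)
type_synonym 'a tensor = "pos list \<Rightarrow> 'a"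

definition words :: "nat \<Rightarrow> nat \<Rightarrow> pos list set" where
  "words N m = {w. set w \<subseteq> {..<N} \<times> {..<N} \<and> length w = m}"

(* y_1 \<otimes> ... \<otimes> y_m *)
definition pure_tensor :: "nat \<Rightarrow> 'a::field_char_0 mat list \<Rightarrow> 'a tensor" where
  "pure_tensor N ys w =
     (if w \<in> words N (length ys) then \<Prod>l<length ys. (ys ! l) $$ (w ! l) else 0)"

definition sym_tensor :: "nat \<Rightarrow> 'a::field_char_0 mat list \<Rightarrow> 'a tensor" where
  "sym_tensor N ys w =
     (\<Sum>\<sigma> | \<sigma> permutes {..<length ys}. pure_tensor N (permute_list \<sigma> ys) w) / fact (length ys)"

(* Linear extension of y_1...y_m \<mapsto> sym_tensor N [y_1,...,y_m] from monomials in the matrix units.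
   The order in which the factors of a monomial are listed is irrelevant; symmetrisation_prod below
   gives the defining formula for arbitrary y_1, ..., y_m. *)
definition symmetrisation :: "nat \<Rightarrow> 'a::field_char_0 sym_alg \<Rightarrow> 'a tensor" where
  "symmetrisation N P w =
     (\<Sum>M \<in> Poly_Mapping.keys P. Poly_Mapping.lookup P M *
        sym_tensor N (map (E_mat N) (SOME u. mset u = M)) w)"

(* Elements of gl(g) \<otimes> (tensor power of gl(2n)), g = sp(2n): the value at w is the endomorphism of g
   that is the coefficient of E_(w!0) \<otimes> E_(w!1) \<otimes> ... .  Endomorphisms of g are functions
   restricted to g, so equality of such functions is equality in the tensor product. *)
type_synonym 'a op_tensor = "pos list \<Rightarrow> 'a mat \<Rightarrow> 'a mat"

definition op_scale :: "nat \<Rightarrow> 'a::field_char_0 \<Rightarrow> 'a op_tensor \<Rightarrow> 'a op_tensor" where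
  "op_scale n c \<Phi> w = (\<lambda>x \<in> sp n. c \<cdot>\<^sub>m \<Phi> w x)"

(* The linear map  y_1 \<otimes> ... \<otimes> y_m \<mapsto> ad y_1 ... ad y_q \<otimes> y_(q+1) \<otimes> ... \<otimes> y_m,
   see ad_contract_pure_tensor.  For q = 1 it is the embedding
   of g \<otimes> (tensor power of g) into gl(g) \<otimes> (tensor power of g) via ad. *)
definition ad_contract :: "nat \<Rightarrow> nat \<Rightarrow> 'a::field_char_0 tensor \<Rightarrow> 'a op_tensor" where
  "ad_contract n q T w = (\<lambda>x \<in> sp n. mat (2*n) (2*n) (\<lambda>p.
     \<Sum>u \<in> words (2*n) q. T (u @ w) * foldr ad (map (E_mat (2*n)) u) x $$ p))"

definition m_map :: "nat \<Rightarrow> nat \<Rightarrow> 'a::field_char_0 sym_alg \<Rightarrow> 'a op_tensor" where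
  "m_map n q P = ad_contract n q (symmetrisation (2*n) P)"

(* An element of S(g), symmetrised and regarded as an element of gl(g) \<otimes> (tensor power of g). *)
definition ad_embed :: "nat \<Rightarrow> 'a::field_char_0 sym_alg \<Rightarrow> 'a op_tensor" where
  "ad_embed n P = ad_contract n 1 (symmetrisation (2*n) P)"

subsection \<open>The defining formulas on arbitrary products and decomposable tensors\<close>

lemma E_mat_carrier [simp]: "E_mat N p \<in> carrier_mat N N"
  by (simp add: E_mat_def)

lemma words_0: "words N 0 = {[]}"
  by (auto simp: words_def)

lemma words_Suc: "words N (Suc m) = (\<lambda>(p, u). p # u) ` (({..<N} \<times> {..<N}) \<times> words N m)"
  by (auto simp: words_def length_Suc_conv image_iff)

lemma finite_words [simp]: "finite (words N m)"
  by (simp add: words_def finite_lists_length_eq)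

lemma sum_words_Suc:
  "(\<Sum>u \<in> words N (Suc m). f u) = (\<Sum>p \<in> {..<N} \<times> {..<N}. \<Sum>u \<in> words N m. f (p # u))"
proof -
  have "inj_on (\<lambda>(p, u). p # u) (({..<N} \<times> {..<N}) \<times> words N m)"
    by (auto simp: inj_on_def)
  then show ?thesis
    unfolding words_Suc by (subst sum.reindex) (auto simp: sum.cartesian_product case_prod_unfold)
qed

lemma pure_tensor_E:
  assumes "set u \<subseteq> {..<N} \<times> {..<N}"
  shows "pure_tensor N (map (E_mat N) u) w = (if u = w then 1 else 0 :: 'a::field_char_0)"
proof (cases "w \<in> words N (length u)")
  case False
  then have "u \<noteq> w" using assms by (auto simp: words_def)
  with False show ?thesis by (simp add: pure_tensor_def)
next
  case True
  then have len: "length w = length u" and w: "set w \<subseteq> {..<N} \<times> {..<N}" by (auto simp: words_def)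
  have entry: "E_mat N (u ! l) $$ (w ! l) = (if w ! l = u ! l then 1 else 0 :: 'a)"
    if "l < length u" for l
  proof -
    have "w ! l \<in> {..<N} \<times> {..<N}" using w len that by (metis nth_mem subsetD)
    then show ?thesis by (cases "w ! l") (auto simp: E_mat_def)
  qed
  have "pure_tensor N (map (E_mat N) u) w
      = (\<Prod>l<length u. if w ! l = u ! l then 1 else 0 :: 'a)"
    using True entry by (simp add: pure_tensor_def)
  also have "\<dots> = (if u = w then 1 else 0)"
  proof (cases "u = w")
    case False
    then obtain l where "l < length u" "w ! l \<noteq> u ! l" using len by (metis nth_equalityI)
    then have "(\<Prod>l<length u. if w ! l = u ! l then 1 else 0 :: 'a) = 0"
      by (intro prod_zero) auto
    with False show ?thesis by simp
  qed simp
  finally show ?thesis .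
qed

lemma sym_tensor_E:
  assumes "set u \<subseteq> {..<N} \<times> {..<N}"
  shows "sym_tensor N (map (E_mat N) u) w
    = (\<Sum>\<sigma> | \<sigma> permutes {..<length u}. if permute_list \<sigma> u = w then 1 else 0 :: 'a::field_char_0)
      / fact (length u)"
proof -
  have "pure_tensor N (permute_list \<sigma> (map (E_mat N) u)) w
      = (if permute_list \<sigma> u = w then 1 else 0 :: 'a)" if "\<sigma> permutes {..<length u}" for \<sigma>
    using that assms by (subst permute_list_map) (auto simp: pure_tensor_E)
  then show ?thesis by (simp add: sym_tensor_def)
qed

lemma sym_tensor_permute:
  assumes "\<tau> permutes {..<length ys}"
  shows "sym_tensor N (permute_list \<tau> ys) w = sym_tensor N ys w"
proof -
  have "(\<Sum>\<sigma> | \<sigma> permutes {..<length ys}. pure_tensor N (permute_list \<sigma> ys) w)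
      = (\<Sum>\<sigma> | \<sigma> permutes {..<length ys}. pure_tensor N (permute_list (\<tau> \<circ> \<sigma>) ys) w)"
    by (rule setum_permutations_compose_left[OF assms])
  also have "\<dots> = (\<Sum>\<sigma> | \<sigma> permutes {..<length ys}.
      pure_tensor N (permute_list \<sigma> (permute_list \<tau> ys)) w)"
    by (intro sum.cong refl) (simp add: permute_list_compose)
  finally show ?thesis by (simp add: sym_tensor_def)
qed

lemma sym_tensor_mset:
  assumes "mset xs = mset ys"
  shows "sym_tensor N xs w = sym_tensor N ys w"
proof -
  obtain \<tau> where "\<tau> permutes {..<length ys}" "permute_list \<tau> ys = xs"
    using mset_eq_permutation[OF assms] by blast
  then show ?thesis using sym_tensor_permute by metis
qed

lemma symmetrisation_superset:
  assumes "finite K" "Poly_Mapping.keys P \<subseteq> K"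
  shows "symmetrisation N P w = (\<Sum>M \<in> K. Poly_Mapping.lookup P M *
        sym_tensor N (map (E_mat N) (SOME u. mset u = M)) w)"
  unfolding symmetrisation_def
  by (rule sum.mono_neutral_left) (use assms in \<open>auto simp: in_keys_iff\<close>)

lemma symmetrisation_zero [simp]: "symmetrisation N 0 w = 0"
  by (simp add: symmetrisation_def)

lemma symmetrisation_add:
  "symmetrisation N (P + Q) w = symmetrisation N P w + symmetrisation N Q w"
proof -
  let ?K = "Poly_Mapping.keys P \<union> Poly_Mapping.keys Q"
  have "Poly_Mapping.keys (P + Q) \<subseteq> ?K" by (rule Poly_Mapping.keys_add)
  then show ?thesis
    by (subst (1 2 3) symmetrisation_superset[where K = ?K])
       (auto simp: lookup_add distrib_right sum.distrib)
qed

lemma symmetrisation_sum: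
  "symmetrisation N (sum P A) w = (\<Sum>a\<in>A. symmetrisation N (P a) w)"
  by (induction A rule: infinite_finite_induct) (auto simp: symmetrisation_add)

lemma symmetrisation_single:
  "symmetrisation N (Poly_Mapping.single (mset u) c) w = c * sym_tensor N (map (E_mat N) u) w"
proof -
  have "mset (SOME v. mset v = mset u) = mset u" by (rule someI) simp
  then have "sym_tensor N (map (E_mat N) (SOME v. mset v = mset u)) w
      = sym_tensor N (map (E_mat N) u) w"
    by (intro sym_tensor_mset) simp
  then show ?thesis
    by (subst symmetrisation_superset[where K = "{mset u}"]) auto
qed

lemma prod_sym_of:
  "(\<Prod>y\<leftarrow>ys. sym_of N y)
    = (\<Sum>u \<in> words N (length ys).
        Poly_Mapping.single (mset u) (\<Prod>l<length ys. (ys ! l) $$ (u ! l)))"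
proof (induction ys)
  case Nil
  then show ?case by (simp add: words_0)
next
  case (Cons y ys)
  have "(\<Prod>y\<leftarrow>y # ys. sym_of N y)
      = sym_of N y * (\<Sum>u \<in> words N (length ys).
          Poly_Mapping.single (mset u) (\<Prod>l<length ys. (ys ! l) $$ (u ! l)))"
    by (simp add: Cons.IH)
  then show ?case
    by (simp add: sum_words_Suc sym_of_def sum_product mult_single prod.lessThan_Suc_shift
          del: prod.lessThan_Suc)
qed

lemma symmetrisation_prod:
  fixes ys :: "'a::field_char_0 mat list"
  shows "symmetrisation N (\<Prod>y\<leftarrow>ys. sym_of N y) = sym_tensor N ys"
proof
  fix w
  let ?m = "length ys"
  let ?Y = "\<lambda>u. \<Prod>l<?m. (ys ! l) $$ (u ! l)"
  let ?Perms = "{\<sigma>. \<sigma> permutes {..<?m}}"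
  have step: "(\<Sum>u\<in>words N ?m. ?Y u * (if permute_list \<sigma> u = w then 1 else 0))
      = pure_tensor N (permute_list \<sigma> ys) w" if \<sigma>: "\<sigma> permutes {..<?m}" for \<sigma>
  proof (cases "w \<in> words N ?m")
    case False
    have "permute_list \<sigma> u \<noteq> w" if "u \<in> words N ?m" for u
      using False \<sigma> that by (auto simp: words_def)
    with False show ?thesis by (auto simp: pure_tensor_def intro!: sum.neutral)
  next
    case True
    let ?v = "permute_list (inv_into UNIV \<sigma>) w"
    have len: "length w = ?m" using True by (simp add: words_def)
    have inv: "inv_into UNIV \<sigma> permutes {..<?m}" using \<sigma> by (rule permutes_inv)
    have v: "?v \<in> words N ?m" using True inv by (simp add: words_def)
    have uniq: "permute_list \<sigma> u = w \<longleftrightarrow> u = ?v" if "u \<in> words N ?m" for u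
    proof
      have lu: "length u = ?m" using that by (simp add: words_def)
      assume "permute_list \<sigma> u = w"
      then have "?v = permute_list (\<sigma> \<circ> inv_into UNIV \<sigma>) u"
        using inv lu by (simp add: permute_list_compose)
      then show "u = ?v" using permutes_inv_o(1)[OF \<sigma>] by simp
    next
      assume "u = ?v"
      then have "permute_list \<sigma> u = permute_list (inv_into UNIV \<sigma> \<circ> \<sigma>) w"
        using \<sigma> len by (simp add: permute_list_compose)
      then show "permute_list \<sigma> u = w" using permutes_inv_o(2)[OF \<sigma>] by simp
    qed
    have "(\<Sum>u\<in>words N ?m. ?Y u * (if permute_list \<sigma> u = w then 1 else 0))
        = (\<Sum>u\<in>words N ?m. if u = ?v then ?Y u else 0)"
      by (intro sum.cong refl) (simp add: uniq)
    also have "\<dots> = ?Y ?v" using v by simp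
    also have "\<dots> = (\<Prod>l<?m. (ys ! \<sigma> l) $$ (?v ! \<sigma> l))"
      using prod.permute[OF \<sigma>, of "\<lambda>l. (ys ! l) $$ (?v ! l)"] by (simp add: comp_def)
    also have "\<dots> = (\<Prod>l<?m. (permute_list \<sigma> ys ! l) $$ (w ! l))"
    proof (intro prod.cong refl)
      fix l assume l: "l \<in> {..<?m}"
      then have "\<sigma> l < ?m" using permutes_in_image[OF \<sigma>] by auto
      then have "?v ! \<sigma> l = w ! l"
        using inv len permutes_inverses(2)[OF \<sigma>] by (simp add: permute_list_nth)
      then show "(ys ! \<sigma> l) $$ (?v ! \<sigma> l) = (permute_list \<sigma> ys ! l) $$ (w ! l)"
        using \<sigma> l by (simp add: permute_list_nth)
    qed
    finally show ?thesis using True by (simp add: pure_tensor_def)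
  qed
  have "symmetrisation N (\<Prod>y\<leftarrow>ys. sym_of N y) w
      = (\<Sum>u\<in>words N ?m. ?Y u * sym_tensor N (map (E_mat N) u) w)"
    by (simp add: prod_sym_of symmetrisation_sum symmetrisation_single)
  also have "\<dots> = (\<Sum>u\<in>words N ?m. ?Y u *
      ((\<Sum>\<sigma>\<in>?Perms. if permute_list \<sigma> u = w then 1 else 0) / fact ?m))"
    by (intro sum.cong refl) (auto simp: sym_tensor_E words_def)
  also have "\<dots> = (\<Sum>u\<in>words N ?m. \<Sum>\<sigma>\<in>?Perms. ?Y u * (if permute_list \<sigma> u = w then 1 else 0)) / fact ?m"
    by (simp add: sum_divide_distrib sum_distrib_left)
  also have "\<dots> = (\<Sum>\<sigma>\<in>?Perms. \<Sum>u\<in>words N ?m. ?Y u * (if permute_list \<sigma> u = w then 1 else 0)) / fact ?m"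
    by (subst sum.swap) simp
  also have "\<dots> = sym_tensor N ys w"
    unfolding sym_tensor_def by (intro arg_cong2[where f = "(/)"] sum.cong refl) (use step in auto)
  finally show "symmetrisation N (\<Prod>y\<leftarrow>ys. sym_of N y) w = sym_tensor N ys w" .
qed

lemma ad_carrier [simp]:
  "y \<in> carrier_mat N N \<Longrightarrow> x \<in> carrier_mat N N \<Longrightarrow> ad y x \<in> carrier_mat N N"
  unfolding ad_def by (metis minus_carrier_mat mult_carrier_mat)

lemma foldr_ad_carrier:
  "set ys \<subseteq> carrier_mat N N \<Longrightarrow> x \<in> carrier_mat N N \<Longrightarrow> foldr ad ys x \<in> carrier_mat N N"
  by (induction ys) auto

lemma ad_index:
  assumes "y \<in> carrier_mat N N" "x \<in> carrier_mat N N" "i < N" "j < N"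
  shows "ad y x $$ (i, j) = (\<Sum>k<N. y $$ (i, k) * x $$ (k, j) - x $$ (i, k) * y $$ (k, j))"
  using assms by (auto simp: ad_def scalar_prod_def sum_subtractf lessThan_atLeast0)

lemma ad_expand:
  assumes y: "y \<in> carrier_mat N N" and x: "x \<in> carrier_mat N N" and ij: "i < N" "j < N"
  shows "ad y x $$ (i, j) = (\<Sum>p \<in> {..<N} \<times> {..<N}. y $$ p * ad (E_mat N p) x $$ (i, j))"
proof -
  have "(\<Sum>p \<in> {..<N} \<times> {..<N}. y $$ p * ad (E_mat N p) x $$ (i, j))
     = (\<Sum>p \<in> {..<N} \<times> {..<N}. \<Sum>k<N.
          y $$ p * (if p = (i, k) then x $$ (k, j) else 0)
        - y $$ p * (if p = (k, j) then x $$ (i, k) else 0))"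
    using ij x by (intro sum.cong refl)
      (auto simp: ad_index[where N = N] sum_distrib_left E_mat_def right_diff_distrib intro!: sum.cong)
  also have "\<dots> = (\<Sum>k<N. \<Sum>p \<in> {..<N} \<times> {..<N}.
          y $$ p * (if p = (i, k) then x $$ (k, j) else 0)
        - y $$ p * (if p = (k, j) then x $$ (i, k) else 0))"
    by (rule sum.swap)
  also have "\<dots> = (\<Sum>k<N. (\<Sum>p \<in> {..<N} \<times> {..<N}. if p = (i, k) then y $$ p * x $$ (k, j) else 0)
        - (\<Sum>p \<in> {..<N} \<times> {..<N}. if p = (k, j) then y $$ p * x $$ (i, k) else 0))"
    unfolding sum_subtractf[symmetric] by (intro sum.cong refl) simp
  also have "\<dots> = (\<Sum>k<N. y $$ (i, k) * x $$ (k, j) - x $$ (i, k) * y $$ (k, j))"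
    using ij by (intro sum.cong refl) simp
  finally show ?thesis using assms by (simp add: ad_index)
qed

lemma ad_sum:
  assumes y: "y \<in> carrier_mat N N" and X: "\<And>u. u \<in> U \<Longrightarrow> X u \<in> carrier_mat N N"
    and ij: "i < N" "j < N"
  shows "ad y (mat N N (\<lambda>p. \<Sum>u\<in>U. c u * X u $$ p)) $$ (i, j) = (\<Sum>u\<in>U. c u * ad y (X u) $$ (i, j))"
proof -
  have "(\<Sum>u\<in>U. c u * ad y (X u) $$ (i, j))
      = (\<Sum>u\<in>U. \<Sum>k<N. y $$ (i, k) * (c u * X u $$ (k, j)) - c u * X u $$ (i, k) * y $$ (k, j))"
    using y X ij by (intro sum.cong refl) (simp add: ad_index sum_distrib_left algebra_simps)
  also have "\<dots> = (\<Sum>k<N. \<Sum>u\<in>U. y $$ (i, k) * (c u * X u $$ (k, j)) - c u * X u $$ (i, k) * y $$ (k, j))"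
    by (rule sum.swap)
  finally show ?thesis
    using y ij by (subst ad_index[where N = N]) (auto simp: sum_subtractf sum_distrib_left sum_distrib_right)
qed

lemma foldr_ad_expand:
  assumes "set ys \<subseteq> carrier_mat N N" and x: "x \<in> carrier_mat N N"
  shows "foldr ad ys x = mat N N (\<lambda>p. \<Sum>u\<in>words N (length ys).
      (\<Prod>l<length ys. (ys ! l) $$ (u ! l)) * foldr ad (map (E_mat N) u) x $$ p)"
  using assms(1)
proof (induction ys)
  case Nil
  then show ?case using x by (auto simp: words_0)
next
  case (Cons y ys)
  let ?Y = "\<lambda>u. \<Prod>l<length ys. (ys ! l) $$ (u ! l)"
  let ?X = "\<lambda>u. foldr ad (map (E_mat N) u) x"
  have y: "y \<in> carrier_mat N N" and ys: "set ys \<subseteq> carrier_mat N N" using Cons.prems by auto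
  have X: "?X u \<in> carrier_mat N N" for u using x by (intro foldr_ad_carrier) auto
  have fy: "foldr ad (y # ys) x \<in> carrier_mat N N"
    using Cons.prems x by (rule foldr_ad_carrier)
  show ?case
  proof (rule eq_matI)
    fix i j
    assume "i < dim_row (mat N N (\<lambda>p. \<Sum>u\<in>words N (length (y # ys)).
      (\<Prod>l<length (y # ys). ((y # ys) ! l) $$ (u ! l)) * ?X u $$ p))"
      "j < dim_col (mat N N (\<lambda>p. \<Sum>u\<in>words N (length (y # ys)).
      (\<Prod>l<length (y # ys). ((y # ys) ! l) $$ (u ! l)) * ?X u $$ p))"
    then have ij: "i < N" "j < N" by auto
    have "foldr ad (y # ys) x $$ (i, j)
        = ad y (mat N N (\<lambda>p. \<Sum>u\<in>words N (length ys). ?Y u * ?X u $$ p)) $$ (i, j)"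
      using Cons.IH[OF ys] by simp
    also have "\<dots> = (\<Sum>u\<in>words N (length ys). ?Y u * ad y (?X u) $$ (i, j))"
      using y X ij by (rule ad_sum)
    also have "\<dots> = (\<Sum>u\<in>words N (length ys). \<Sum>p\<in>{..<N} \<times> {..<N}.
        y $$ p * ?Y u * ad (E_mat N p) (?X u) $$ (i, j))"
      by (simp add: ad_expand[OF y X ij] sum_distrib_left mult_ac)
    also have "\<dots> = (\<Sum>p\<in>{..<N} \<times> {..<N}. \<Sum>u\<in>words N (length ys).
        y $$ p * ?Y u * ad (E_mat N p) (?X u) $$ (i, j))"
      by (rule sum.swap)
    finally show "foldr ad (y # ys) x $$ (i, j) = mat N N (\<lambda>p. \<Sum>u\<in>words N (length (y # ys)).
      (\<Prod>l<length (y # ys). ((y # ys) ! l) $$ (u ! l)) * ?X u $$ p) $$ (i, j)"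
      using ij by (simp add: sum_words_Suc prod.lessThan_Suc_shift del: prod.lessThan_Suc)
  qed (use fy in auto)
qed

lemma F_elt_carrier [simp]: "F_elt n i j \<in> carrier_mat (2*n) (2*n)"
  unfolding F_elt_def by (rule minus_carrier_mat) simp

lemma sp_carrier: "x \<in> sp n \<Longrightarrow> x \<in> carrier_mat (2*n) (2*n)"
  by (auto simp: sp_def)

lemma prod_lessThan_add:
  fixes f :: "nat \<Rightarrow> 'b::comm_monoid_mult"
  shows "prod f {..<a + b} = prod f {..<a} * (\<Prod>l<b. f (a + l))"
  by (induction b) (simp_all add: mult.assoc)

lemma ad_contract_pure_tensor:
  assumes ys: "set ys \<subseteq> carrier_mat (2*n) (2*n)" and q: "q \<le> length ys"
  shows "ad_contract n q (pure_tensor (2*n) ys) w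
    = (\<lambda>x \<in> sp n. pure_tensor (2*n) (drop q ys) w \<cdot>\<^sub>m foldr ad (take q ys) x)"
  unfolding ad_contract_def
proof (rule restrict_ext)
  fix x :: "'a mat" assume x: "x \<in> sp n"
  let ?N = "2*n" and ?X = "\<lambda>u. foldr ad (map (E_mat (2*n)) u) x"
  have xc: "x \<in> carrier_mat ?N ?N" using x by (rule sp_carrier)
  have tq: "set (take q ys) \<subseteq> carrier_mat ?N ?N" using ys set_take_subset by fast
  have len: "length (take q ys) = q" using q by simp
  have split: "pure_tensor ?N ys (u @ w)
      = (\<Prod>l<q. (take q ys ! l) $$ (u ! l)) * pure_tensor ?N (drop q ys) w"
    if u: "u \<in> words ?N q" for u
  proof -
    have lu: "length u = q" using u by (simp add: words_def)
    have iff: "u @ w \<in> words ?N (length ys) \<longleftrightarrow> w \<in> words ?N (length ys - q)"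
      using u q by (auto simp: words_def)
    have "(\<Prod>l<length ys. (ys ! l) $$ ((u @ w) ! l))
        = (\<Prod>l<q + (length ys - q). (ys ! l) $$ ((u @ w) ! l))"
      using q by simp
    also have "\<dots> = (\<Prod>l<q. (ys ! l) $$ ((u @ w) ! l))
        * (\<Prod>l<length ys - q. (ys ! (q + l)) $$ ((u @ w) ! (q + l)))"
      by (rule prod_lessThan_add)
    also have "\<dots> = (\<Prod>l<q. (take q ys ! l) $$ (u ! l))
        * (\<Prod>l<length ys - q. (drop q ys ! l) $$ (w ! l))"
      using lu q by (simp add: nth_append)
    finally show ?thesis using iff by (simp add: pure_tensor_def)
  qed
  show "mat ?N ?N (\<lambda>p. \<Sum>u\<in>words ?N q. pure_tensor ?N ys (u @ w) * ?X u $$ p)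
      = pure_tensor ?N (drop q ys) w \<cdot>\<^sub>m foldr ad (take q ys) x"
    unfolding foldr_ad_expand[OF tq xc] len
  proof (rule eq_matI, goal_cases)
    case (1 i j)
    have "(\<Sum>u\<in>words ?N q. pure_tensor ?N ys (u @ w) * ?X u $$ (i, j))
        = (\<Sum>u\<in>words ?N q. pure_tensor ?N (drop q ys) w
            * ((\<Prod>l<q. (take q ys ! l) $$ (u ! l)) * ?X u $$ (i, j)))"
      by (intro sum.cong refl) (subst split, auto simp: mult_ac)
    with 1 show ?case by (simp add: sum_distrib_left)
  qed auto
qed

lemma prime_idx:
  assumes "i < 2*n"
  shows "prime_idx n i < 2*n" "prime_idx n (prime_idx n i) = i"
    "eps n (prime_idx n i) = (- eps n i :: 'a::field_char_0)"
  using assms by (auto simp: prime_idx_def eps_def)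

lemma eps_sq [simp]: "eps n i * eps n i = (1 :: 'a::field_char_0)"
  "eps n i * (eps n i * a) = (a :: 'a)"
  by (simp_all add: eps_def)

lemma F_elt_index:
  assumes "a < 2*n" "b < 2*n" "i < 2*n" "j < 2*n"
  shows "(F_elt n i j :: 'a::field_char_0 mat) $$ (a, b) = (if i = a \<and> j = b then 1 else 0)
    - eps n a * eps n b * (if i = prime_idx n b \<and> j = prime_idx n a then 1 else 0)"
proof -
  have E1: "(E_mat (2*n) (i, j) :: 'a mat) $$ (a, b) = (if i = a \<and> j = b then 1 else 0)"
    using assms by (simp add: E_mat_def eq_commute)
  have "(a, b) = (prime_idx n j, prime_idx n i) \<longleftrightarrow> i = prime_idx n b \<and> j = prime_idx n a"
    using assms by (auto simp: prime_idx)
  then have E2: "(E_mat (2*n) (prime_idx n j, prime_idx n i) :: 'a mat) $$ (a, b)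
      = (if i = prime_idx n b \<and> j = prime_idx n a then 1 else 0)"
    using assms by (simp add: E_mat_def)
  have eps_eq: "eps n i * eps n j = (eps n a * eps n b :: 'a)"
    if "i = prime_idx n b \<and> j = prime_idx n a"
    using that assms by (simp add: prime_idx mult.commute)
  have "(F_elt n i j :: 'a mat) $$ (a, b) = E_mat (2*n) (i, j) $$ (a, b)
      - eps n i * eps n j * E_mat (2*n) (prime_idx n j, prime_idx n i) $$ (a, b)"
    using assms by (simp add: F_elt_def E_mat_def)
  then show ?thesis unfolding E1 E2 using eps_eq by simp
qed

lemma sum_F_elt_index:
  fixes c :: "nat \<Rightarrow> nat \<Rightarrow> 'a::field_char_0"
  assumes ab: "a < 2*n" "b < 2*n"
  shows "(\<Sum>i<2*n. \<Sum>j<2*n. c i j * F_elt n i j $$ (a, b))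
    = c a b - eps n a * eps n b * c (prime_idx n b) (prime_idx n a)"
proof -
  let ?N = "2*n"
  have delta: "(\<Sum>i<?N. \<Sum>j<?N. if i = p \<and> j = q then d i j else 0) = d p q"
    if "p < ?N" "q < ?N" for p q and d :: "nat \<Rightarrow> nat \<Rightarrow> 'a"
  proof -
    have "(\<Sum>j<?N. if i = p \<and> j = q then d i j else 0) = (if i = p then d i q else 0)" for i
      using that(2) by (cases "i = p") simp_all
    then show ?thesis using that(1) by simp
  qed
  have "c i j * F_elt n i j $$ (a, b) = (if i = a \<and> j = b then c i j else 0)
      - (if i = prime_idx n b \<and> j = prime_idx n a then eps n a * eps n b * c i j else 0)"
    if "i < ?N" "j < ?N" for i j
  proof -
    have *: "c i j * ((if P then 1 else 0) - eps n a * eps n b * (if Q then 1 else 0))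
        = (if P then c i j else 0) - (if Q then eps n a * eps n b * c i j else 0)" for P Q
      by (simp only: right_diff_distrib mult.commute split: if_split) simp
    show ?thesis unfolding F_elt_index[OF ab that] by (rule *)
  qed
  then have "(\<Sum>i<?N. \<Sum>j<?N. c i j * F_elt n i j $$ (a, b))
      = (\<Sum>i<?N. \<Sum>j<?N. (if i = a \<and> j = b then c i j else 0)
          - (if i = prime_idx n b \<and> j = prime_idx n a then eps n a * eps n b * c i j else 0))"
    by (intro sum.cong refl) blast
  also have "\<dots> = c a b - eps n a * eps n b * c (prime_idx n b) (prime_idx n a)"
    unfolding sum_subtractf delta[OF ab] delta[OF prime_idx(1)[OF ab(2)] prime_idx(1)[OF ab(1)]] ..
  finally show ?thesis .
qed

lemma sp_iff:
  "(A :: 'a::field_char_0 mat) \<in> sp n \<longleftrightarrow> A \<in> carrier_mat (2*n) (2*n) \<and>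
    (\<forall>i<2*n. \<forall>j<2*n. A $$ (prime_idx n j, prime_idx n i) = - (eps n i * eps n j * A $$ (i, j)))"
  (is "?L \<longleftrightarrow> ?R")
proof
  assume ?L
  then obtain c where A: "A = mat (2*n) (2*n) (\<lambda>p. \<Sum>i<2*n. \<Sum>j<2*n. c i j * F_elt n i j $$ p)"
    by (auto simp: sp_def)
  have entry: "A $$ (i, j) = c i j - eps n i * eps n j * c (prime_idx n j) (prime_idx n i)"
    if "i < 2*n" "j < 2*n" for i j
    using that by (simp add: A sum_F_elt_index)
  have "A $$ (prime_idx n j, prime_idx n i) = - (eps n i * eps n j * A $$ (i, j))"
    if ij: "i < 2*n" "j < 2*n" for i j
  proof -
    have "A $$ (prime_idx n j, prime_idx n i)
        = c (prime_idx n j) (prime_idx n i) - eps n j * eps n i * c i j"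
      using entry[of "prime_idx n j" "prime_idx n i"] ij by (simp add: prime_idx)
    then show ?thesis
      using entry[OF ij] by (simp add: eps_def)
  qed
  moreover have "A \<in> carrier_mat (2*n) (2*n)" by (simp add: A)
  ultimately show ?R by blast
next
  assume R: ?R
  define c where "c i j = A $$ (i, j) / 2" for i j
  have "A = mat (2*n) (2*n) (\<lambda>p. \<Sum>i<2*n. \<Sum>j<2*n. c i j * F_elt n i j $$ p)"
  proof (rule eq_matI, goal_cases)
    case (1 i j)
    then have ij: "i < 2*n" "j < 2*n" by auto
    then have "A $$ (prime_idx n j, prime_idx n i) = - (eps n i * eps n j * A $$ (i, j))"
      using R by blast
    then have "A $$ (i, j) = c i j - eps n i * eps n j * c (prime_idx n j) (prime_idx n i)"
      by (simp add: c_def eps_def)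
    with ij show ?case by (simp add: sum_F_elt_index)
  qed (use R in auto)
  then show ?L unfolding sp_def by blast
qed

(* The operators in ad_contract are endomorphisms of g. *)
lemma ad_sp:
  fixes x y :: "'a::field_char_0 mat"
  assumes y: "y \<in> sp n" and x: "x \<in> sp n"
  shows "ad y x \<in> sp n"
proof -
  let ?p = "prime_idx n"
  have yc: "y \<in> carrier_mat (2*n) (2*n)" and xc: "x \<in> carrier_mat (2*n) (2*n)"
    using x y by (auto simp: sp_iff)
  have ys: "y $$ (?p j, ?p i) = - (eps n i * eps n j * y $$ (i, j))"
    and xs: "x $$ (?p j, ?p i) = - (eps n i * eps n j * x $$ (i, j))"
    if "i < 2*n" "j < 2*n" for i j
    using x y that by (auto simp: sp_iff)
  have "ad y x $$ (?p j, ?p i) = - (eps n i * eps n j * ad y x $$ (i, j))"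
    if ij: "i < 2*n" "j < 2*n" for i j
  proof -
    have bij: "bij_betw ?p {..<2*n} {..<2*n}"
      by (rule bij_betwI[where g = ?p]) (auto simp: prime_idx)
    have "ad y x $$ (?p j, ?p i)
        = (\<Sum>k<2*n. y $$ (?p j, k) * x $$ (k, ?p i) - x $$ (?p j, k) * y $$ (k, ?p i))"
      using yc xc ij by (intro ad_index) (auto simp: prime_idx)
    also have "\<dots> = (\<Sum>k<2*n. y $$ (?p j, ?p k) * x $$ (?p k, ?p i)
        - x $$ (?p j, ?p k) * y $$ (?p k, ?p i))"
      by (rule sum.reindex_bij_betw[OF bij, symmetric])
    also have "\<dots> = (\<Sum>k<2*n. - (eps n i * eps n j)
        * (y $$ (i, k) * x $$ (k, j) - x $$ (i, k) * y $$ (k, j)))"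
      using ij by (intro sum.cong refl) (simp add: xs ys algebra_simps)
    finally show ?thesis
      unfolding ad_index[OF yc xc ij] by (simp add: sum_distrib_left sum_negf)
  qed
  then show ?thesis using xc yc by (auto simp: sp_iff)
qed

end

theory Submission
  imports Defs
begin

text \<open>
  Let \<psi>'_i and \<psi>_i be anticommuting variables. The products z_ij = \<psi>'_i \<psi>_j commute, satisfy
  z_ij z_kl = - z_il z_kj, and a Berezin integral maps z_(i_1 j_1) ... z_(i_d j_d) to the
  determinant of the matrix with entries \<delta>(j_l, i_m). Hence the symmetrisation of \<Delta>_d is, up to 1/d!,
  the Berezin integral of the d-th tensor power of \<Omega> = \<Sum> z_ij \<otimes> F_ij, and the map m_q
  replaces the first q factors by (ad \<Omega>)^q.

  The pair (sp(2n), sl(2)) acts on the exterior algebra as a Howe dual pair, and \<Omega> factors through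
  the two-dimensional space of sl(2). Therefore \<Omega>^3 = c \<Omega> and, for x in sp(2n), \<Omega> x \<Omega> = s \<Omega>
  with scalars c and s, so that (ad \<Omega>)^3 x = c ad \<Omega> x. Here c = \<theta>^2 + \<tau> is the Casimir
  element of sl(2). Since the entries of \<Omega> are sl(2)-invariant, integration by parts shows that
  multiplying a product of p of them by c multiplies its integral by (2n - p)(2n - p + 1). Removing
  2r factors ad \<Omega> in r such steps produces the quotient of factorials in the statement.
\<close>

subsection \<open>Alternating traces of words\<close>

text \<open>The Leibniz sum of the determinant with entries \<delta>(j_l, i_m), for the word with
  letters (i_l, j_l). It becomes the Berezin integral of the monomial z_(i_1 j_1) ... z_(i_d
  j_d).\<close>

definition alt_trace :: "pos list \<Rightarrow> int" where
  "alt_trace v = (\<Sum>\<sigma> | \<sigma> permutes {..<length v}.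
     sign \<sigma> * (\<Prod>l<length v. of_bool (snd (v ! l) = fst (v ! \<sigma> l))))"

lemma alt_trace_Nil [simp]: "alt_trace [] = 1"
  by (simp add: alt_trace_def)

text \<open>Permuting the letters permutes rows and columns simultaneously, and conjugating the
  summation index by \<tau> leaves its sign unchanged. Hence \<open>alt_trace\<close> depends only
  on the monomial in the commuting z_ij.\<close>

lemma alt_trace_permute:
  assumes \<tau>: "\<tau> permutes {..<length v}"
  shows "alt_trace (permute_list \<tau> v) = alt_trace v"
proof -
  let ?S = "{..<length v}" and ?i = "inv_into UNIV \<tau>"
  have i: "?i permutes ?S" using \<tau> by (rule permutes_inv)
  have "alt_trace v = (\<Sum>\<sigma> | \<sigma> permutes ?S. sign (\<tau> \<circ> \<sigma> \<circ> ?i)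
      * (\<Prod>l\<in>?S. of_bool (snd (v ! l) = fst (v ! (\<tau> \<circ> \<sigma> \<circ> ?i) l))))"
    unfolding alt_trace_def
    by (subst sum_permutations_compose_right[OF i], subst setum_permutations_compose_left[OF \<tau>])
       (simp add: comp_assoc)
  also have "\<dots> = (\<Sum>\<sigma> | \<sigma> permutes ?S. sign \<sigma>
      * (\<Prod>l\<in>?S. of_bool (snd (permute_list \<tau> v ! l) = fst (permute_list \<tau> v ! \<sigma> l))))"
  proof (intro sum.cong refl)
    fix \<sigma> assume "\<sigma> \<in> {\<sigma>. \<sigma> permutes ?S}"
    then have \<sigma>: "\<sigma> permutes ?S" by simp
    have perm: "permutation \<sigma>" "permutation \<tau>" "permutation ?i"
      using \<sigma> \<tau> i by (auto intro: permutes_imp_permutation)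
    have "sign (\<tau> \<circ> \<sigma> \<circ> ?i) = sign \<sigma> * (sign \<tau> * sign \<tau>)"
      using perm by (simp add: sign_compose permutation_compose sign_inverse)
    then have sgn: "sign (\<tau> \<circ> \<sigma> \<circ> ?i) = sign \<sigma>" by simp
    have "(\<Prod>l\<in>?S. of_bool (snd (v ! l) = fst (v ! (\<tau> \<circ> \<sigma> \<circ> ?i) l)) :: int)
        = (\<Prod>l\<in>?S. of_bool (snd (v ! \<tau> l) = fst (v ! (\<tau> \<circ> \<sigma> \<circ> ?i) (\<tau> l))))"
      using prod.permute[OF \<tau>, of "\<lambda>l. of_bool (snd (v ! l) = fst (v ! (\<tau> \<circ> \<sigma> \<circ> ?i) l)) :: int"]
      by (simp add: comp_def)
    also have "\<dots> = (\<Prod>l\<in>?S. of_bool (snd (permute_list \<tau> v ! l) = fst (permute_list \<tau> v ! \<sigma> l)))"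
      using \<tau> permutes_in_image[OF \<sigma>] permutes_inverses(2)[OF \<tau>]
      by (intro prod.cong refl) (simp add: permute_list_nth)
    finally show "sign (\<tau> \<circ> \<sigma> \<circ> ?i) * (\<Prod>l\<in>?S. of_bool (snd (v ! l) = fst (v ! (\<tau> \<circ> \<sigma> \<circ> ?i) l)))
      = sign \<sigma> * (\<Prod>l\<in>?S. of_bool (snd (permute_list \<tau> v ! l) = fst (permute_list \<tau> v ! \<sigma> l)))"
      using sgn by simp
  qed
  also have "\<dots> = alt_trace (permute_list \<tau> v)" by (simp add: alt_trace_def)
  finally show ?thesis ..
qed

lemma alt_trace_mset:
  assumes "mset u = mset v"
  shows "alt_trace u = alt_trace v"
  using mset_eq_permutation[OF assms] alt_trace_permute by metis

text \<open>Exchanging the second indices of two letters swaps two rows of the determinant. This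
  encodes the relation z_ij z_kl = - z_il z_kj.\<close>

lemma alt_trace_exchange:
  "alt_trace ((i, j) # (k, l) # v) = - alt_trace ((i, l) # (k, j) # v)"
proof -
  let ?u = "(i, j) # (k, l) # v" and ?u' = "(i, l) # (k, j) # v"
  let ?t = "transpose 0 (Suc 0)" and ?S = "{..<Suc (Suc (length v))}"
  have t: "?t permutes ?S" by (intro permutes_swap_id) auto
  have snd: "snd (?u' ! m) = snd (?u ! ?t m)" and fst: "fst (?u' ! m) = fst (?u ! m)" for m
    by (auto simp: transpose_def nth_Cons split: nat.split)
  have "alt_trace ?u = (\<Sum>\<sigma> | \<sigma> permutes ?S. sign (\<sigma> \<circ> ?t)
      * (\<Prod>m\<in>?S. of_bool (snd (?u ! m) = fst (?u ! (\<sigma> \<circ> ?t) m))))"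
    unfolding alt_trace_def length_Cons by (rule sum_permutations_compose_right[OF t])
  also have "\<dots> = (\<Sum>\<sigma> | \<sigma> permutes ?S. - (sign \<sigma>
      * (\<Prod>m\<in>?S. of_bool (snd (?u' ! m) = fst (?u' ! \<sigma> m)))))"
  proof (intro sum.cong refl)
    fix \<sigma> assume "\<sigma> \<in> {\<sigma>. \<sigma> permutes ?S}"
    then have "permutation \<sigma>" by (auto intro: permutes_imp_permutation)
    then have sgn: "sign (\<sigma> \<circ> ?t) = - sign \<sigma>"
      by (simp add: sign_compose permutation_swap_id sign_swap_id)
    have "(\<Prod>m\<in>?S. of_bool (snd (?u ! m) = fst (?u ! (\<sigma> \<circ> ?t) m)) :: int)
        = (\<Prod>m\<in>?S. of_bool (snd (?u ! ?t m) = fst (?u ! (\<sigma> \<circ> ?t) (?t m))))"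
      using prod.permute[OF t, of "\<lambda>m. of_bool (snd (?u ! m) = fst (?u ! (\<sigma> \<circ> ?t) m)) :: int"]
      by (simp add: comp_def)
    then show "sign (\<sigma> \<circ> ?t) * (\<Prod>m\<in>?S. of_bool (snd (?u ! m) = fst (?u ! (\<sigma> \<circ> ?t) m)))
        = - (sign \<sigma> * (\<Prod>m\<in>?S. of_bool (snd (?u' ! m) = fst (?u' ! \<sigma> m))))"
      unfolding sgn snd fst by simp
  qed
  also have "\<dots> = - alt_trace ?u'" by (simp add: alt_trace_def sum_negf)
  finally show ?thesis .
qed

text \<open>Expansion of the determinant along the row of the last letter. A permutation sending the
  last place to b factors through the transposition with b, which costs a sign and hands the first
  index i to letter b. This is the source of integration by parts.\<close>

lemma alt_trace_snoc:
  "alt_trace (v @ [(i, j)]) = of_bool (i = j) * alt_trace v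
    - (\<Sum>b<length v. of_bool (j = fst (v ! b)) * alt_trace (v[b := (i, snd (v ! b))]))"
proof -
  let ?m = "length v" and ?w = "v @ [(i, j)]"
  let ?g = "\<lambda>\<sigma>. sign \<sigma> * (\<Prod>l<Suc ?m. of_bool (snd (?w ! l) = fst (?w ! \<sigma> l))) :: int"
  have ins: "{..<Suc ?m} = insert ?m {..<?m}" by auto
  have "alt_trace ?w = (\<Sum>\<sigma> | \<sigma> permutes insert ?m {..<?m}. ?g \<sigma>)"
    by (simp add: alt_trace_def ins)
  also have "\<dots> = (\<Sum>b\<in>insert ?m {..<?m}. \<Sum>\<tau> | \<tau> permutes {..<?m}. ?g (transpose ?m b \<circ> \<tau>))"
    by (rule sum_over_permutations_insert) auto
  also have "\<dots> = (\<Sum>\<tau> | \<tau> permutes {..<?m}. ?g \<tau>)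
      + (\<Sum>b<?m. \<Sum>\<tau> | \<tau> permutes {..<?m}. ?g (transpose ?m b \<circ> \<tau>))"
    by (subst sum.insert) (auto simp: comp_def)
  also have "(\<Sum>\<tau> | \<tau> permutes {..<?m}. ?g \<tau>) = of_bool (i = j) * alt_trace v"
    unfolding alt_trace_def sum_distrib_left
  proof (intro sum.cong refl)
    fix \<tau> assume "\<tau> \<in> {\<tau>. \<tau> permutes {..<?m}}"
    then have \<tau>: "\<tau> permutes {..<?m}" by simp
    have "\<tau> ?m = ?m" using \<tau> by (auto simp: permutes_def)
    moreover have "\<tau> l < ?m" if "l < ?m" for l using permutes_in_image[OF \<tau>] that by auto
    ultimately show "?g \<tau> = of_bool (i = j) *
        (sign \<tau> * (\<Prod>l<?m. of_bool (snd (v ! l) = fst (v ! \<tau> l))))"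
      by (simp add: nth_append eq_commute[of j i])
  qed
  also have "(\<Sum>b<?m. \<Sum>\<tau> | \<tau> permutes {..<?m}. ?g (transpose ?m b \<circ> \<tau>))
      = (\<Sum>b<?m. - (of_bool (j = fst (v ! b)) * alt_trace (v[b := (i, snd (v ! b))])))"
    unfolding alt_trace_def sum_distrib_left sum_negf[symmetric] length_list_update
  proof (intro sum.cong refl)
    fix b \<tau> assume "\<tau> \<in> {\<tau>. \<tau> permutes {..<?m}}" and b: "b \<in> {..<?m}"
    then have \<tau>: "\<tau> permutes {..<?m}" by simp
    let ?v = "v[b := (i, snd (v ! b))]"
    have m: "\<tau> ?m = ?m" using \<tau> by (auto simp: permutes_def)
    have in_S: "\<tau> l < ?m" if "l < ?m" for l using permutes_in_image[OF \<tau>] that by auto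
    have "permutation \<tau>" using \<tau> by (auto intro: permutes_imp_permutation)
    then have sgn: "sign (transpose ?m b \<circ> \<tau>) = - sign \<tau>"
      using b by (simp add: sign_compose permutation_swap_id sign_swap_id)
    \<comment> \<open>The row that \<tau> matches with letter b is now matched with the last letter,
      whose first index is i.\<close>
    have "snd (?w ! l) = snd (?v ! l)" "fst (?w ! (transpose ?m b \<circ> \<tau>) l) = fst (?v ! \<tau> l)"
      if "l < ?m" for l
      using that in_S[OF that] b by (auto simp: nth_append nth_list_update transpose_def)
    then have "(\<Prod>l<?m. of_bool (snd (?w ! l) = fst (?w ! (transpose ?m b \<circ> \<tau>) l)) :: int)
        = (\<Prod>l<?m. of_bool (snd (?v ! l) = fst (?v ! \<tau> l)))"
      by (intro prod.cong refl) auto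
    moreover have "(snd (?w ! ?m) = fst (?w ! (transpose ?m b \<circ> \<tau>) ?m)) = (j = fst (v ! b))"
      using b by (simp add: m nth_append)
    ultimately show "?g (transpose ?m b \<circ> \<tau>) = - (of_bool (j = fst (v ! b)) *
        (sign \<tau> * (\<Prod>l<?m. of_bool (snd (?v ! l) = fst (?v ! \<tau> l)))))"
      by (simp add: sgn)
  qed
  finally show ?thesis by (simp add: sum_negf)
qed

subsection \<open>The algebra generated by the products of two anticommuting variables\<close>

definition mset_trace :: "pos multiset \<Rightarrow> int" where
  "mset_trace M = alt_trace (SOME v. mset v = M)"

lemma mset_trace_mset [simp]: "mset_trace (mset v) = alt_trace v"
proof -
  have "mset (SOME u. mset u = mset v) = mset v" by (rule someI) simp
  then show ?thesis unfolding mset_trace_def by (rule alt_trace_mset)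
qed

lemma mset_trace_exchange:
  "mset_trace (M + {#(i, j), (k, l)#}) = - mset_trace (M + {#(i, l), (k, j)#})"
proof -
  obtain v where v: "mset v = M" using ex_mset by blast
  have "mset_trace (mset ((i, j) # (k, l) # v)) = - mset_trace (mset ((i, l) # (k, j) # v))"
    unfolding mset_trace_mset by (rule alt_trace_exchange)
  then show ?thesis by (simp add: v add.commute add_mset_commute)
qed

text \<open>The Berezin integral before passing to the quotient: the linear extension of the
  determinants from monomials to polynomials.\<close>

definition poly_trace :: "'a::field_char_0 sym_alg \<Rightarrow> 'a" where
  "poly_trace P = (\<Sum>M \<in> Poly_Mapping.keys P. Poly_Mapping.lookup P M * of_int (mset_trace M))"

lemma poly_trace_superset:
  assumes "finite K" "Poly_Mapping.keys P \<subseteq> K"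
  shows "poly_trace P = (\<Sum>M \<in> K. Poly_Mapping.lookup P M * of_int (mset_trace M))"
  unfolding poly_trace_def
  by (rule sum.mono_neutral_left) (use assms in \<open>auto simp: in_keys_iff\<close>)

lemma poly_trace_add: "poly_trace (P + Q) = poly_trace P + poly_trace Q"
proof -
  let ?K = "Poly_Mapping.keys P \<union> Poly_Mapping.keys Q"
  have "Poly_Mapping.keys (P + Q) \<subseteq> ?K" by (rule Poly_Mapping.keys_add)
  then show ?thesis
    by (subst (1 2 3) poly_trace_superset[where K = ?K])
       (auto simp: lookup_add distrib_right sum.distrib)
qed

lemma poly_trace_0 [simp]: "poly_trace 0 = 0"
  by (simp add: poly_trace_def)

lemma poly_trace_sum: "poly_trace (sum f A) = (\<Sum>a\<in>A. poly_trace (f a))"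
  by (induction A rule: infinite_finite_induct) (auto simp: poly_trace_add)

lemma poly_trace_uminus: "poly_trace (- P) = - poly_trace P"
  using poly_trace_add[of P "- P"] by (simp add: eq_neg_iff_add_eq_0 add.commute)

lemma poly_trace_diff: "poly_trace (P - Q) = poly_trace P - poly_trace Q"
  using poly_trace_add[of P "- Q"] by (simp add: poly_trace_uminus)

lemma poly_trace_single [simp]:
  "poly_trace (Poly_Mapping.single M c) = c * of_int (mset_trace M)"
  by (subst poly_trace_superset[where K = "{M}"]) auto

lemma sum_singles: "(\<Sum>M \<in> Poly_Mapping.keys P. Poly_Mapping.single M (Poly_Mapping.lookup P M)) = P"
  by (rule poly_mapping_eqI)
     (auto simp: lookup_sum lookup_single when_def in_keys_iff sum.delta)

lemma poly_trace_scale: "poly_trace (Poly_Mapping.single 0 c * P) = c * poly_trace P"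
proof -
  have "poly_trace (Poly_Mapping.single 0 c *
      (\<Sum>M \<in> Poly_Mapping.keys P. Poly_Mapping.single M (Poly_Mapping.lookup P M))) = c * poly_trace P"
    by (simp add: sum_distrib_left mult_single poly_trace_sum poly_trace_def[of P] mult.assoc)
  then show ?thesis by (simp add: sum_singles)
qed

text \<open>The radical of the trace form is an ideal, so multiplication descends to the
  quotient.\<close>

lemma poly_trace_cong_mult:
  assumes P: "\<And>R. poly_trace (P * R) = poly_trace (P' * R)"
    and Q: "\<And>R. poly_trace (Q * R) = poly_trace (Q' * R)"
  shows "poly_trace (P * Q * R) = poly_trace (P' * Q' * R)"
proof -
  have "poly_trace (P * (Q * R)) = poly_trace (P' * (Q * R))" by (rule P)
  also have "\<dots> = poly_trace (Q * (P' * R))" by (simp only: mult.left_commute)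
  also have "\<dots> = poly_trace (Q' * (P' * R))" by (rule Q)
  finally show ?thesis by (simp only: mult.assoc mult.left_commute)
qed

(* The subalgebra of the exterior algebra generated by the \<psi>'_i \<psi>_j, obtained without constructing the
   exterior algebra: the polynomial ring modulo the radical of the trace form (P, Q) \<mapsto> poly_trace (P * Q). *)
quotient_type (overloaded) 'a minor_alg = "'a::field_char_0 sym_alg" /
  "\<lambda>P Q. \<forall>R. poly_trace (P * R) = poly_trace (Q * R)"
  by (rule equivpI) (auto simp: reflp_def symp_def transp_def)

instantiation minor_alg :: (field_char_0) comm_ring_1
begin

lift_definition zero_minor_alg :: "'a minor_alg" is 0 .
lift_definition one_minor_alg :: "'a minor_alg" is 1 .
lift_definition plus_minor_alg :: "'a minor_alg \<Rightarrow> 'a minor_alg \<Rightarrow> 'a minor_alg" is "(+)"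
  by (simp add: distrib_right poly_trace_add)
lift_definition uminus_minor_alg :: "'a minor_alg \<Rightarrow> 'a minor_alg" is uminus
  by (simp add: poly_trace_uminus)
lift_definition minus_minor_alg :: "'a minor_alg \<Rightarrow> 'a minor_alg \<Rightarrow> 'a minor_alg" is "(-)"
  by (simp add: left_diff_distrib poly_trace_diff)
lift_definition times_minor_alg :: "'a minor_alg \<Rightarrow> 'a minor_alg \<Rightarrow> 'a minor_alg" is "(*)"
  by (rule poly_trace_cong_mult) auto

instance
proof
  show "(0 :: 'a minor_alg) \<noteq> 1"
  proof transfer
    \<comment> \<open>The unit is the monomial of the empty word, whose determinant is 1.\<close>
    have "poly_trace (1 :: 'a sym_alg) = 1"
      using poly_trace_single[of 0 "1 :: 'a"] mset_trace_mset[of "[]"] by simp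
    then have "poly_trace (0 * 1 :: 'a sym_alg) \<noteq> poly_trace (1 * 1)" by simp
    then show "\<not> (\<forall>R. poly_trace (0 * R :: 'a sym_alg) = poly_trace (1 * R))" by blast
  qed
qed (transfer; simp add: algebra_simps)+

end

text \<open>Congruent polynomials have the same integral, as the test multiplier 1 shows.\<close>

lift_definition berezin :: "'a::field_char_0 minor_alg \<Rightarrow> 'a" is poly_trace
  by (drule meta_spec[of _ 1]) simp

lift_definition scalar :: "'a::field_char_0 \<Rightarrow> 'a minor_alg" is "Poly_Mapping.single 0" .

lift_definition gen :: "pos \<Rightarrow> 'a::field_char_0 minor_alg" is "\<lambda>p. Poly_Mapping.single {#p#} 1" .

lemma poly_trace_quadratic:
  "poly_trace (Poly_Mapping.single {#p#} 1 * Poly_Mapping.single {#q#} 1 * P)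
    = (\<Sum>M \<in> Poly_Mapping.keys P. Poly_Mapping.lookup P M * of_int (mset_trace (M + {#p, q#})))"
proof -
  have "poly_trace (Poly_Mapping.single {#p#} 1 * Poly_Mapping.single {#q#} 1
      * (\<Sum>M \<in> Poly_Mapping.keys P. Poly_Mapping.single M (Poly_Mapping.lookup P M)))
      = (\<Sum>M \<in> Poly_Mapping.keys P. Poly_Mapping.lookup P M * of_int (mset_trace (M + {#p, q#})))"
    unfolding sum_distrib_left poly_trace_sum by (simp add: mult_single add_mset_commute)
  then show ?thesis by (simp only: sum_singles)
qed

text \<open>After multiplication by any monomial the two sides are traces that differ by a row swap,
  so they are congruent modulo the radical.\<close>

lemma gen_exchange: "gen (i, j) * gen (k, l) = - (gen (i, l) * gen (k, j))"
proof (transfer, intro allI)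
  fix i j k l and R :: "'a sym_alg"
  let ?z = "\<lambda>p. Poly_Mapping.single {#p#} (1::'a)"
  show "poly_trace (?z (i, j) * ?z (k, l) * R) = poly_trace (- (?z (i, l) * ?z (k, j)) * R)"
    unfolding minus_mult_left[symmetric] poly_trace_uminus poly_trace_quadratic
    by (subst mset_trace_exchange) (simp add: sum_negf)
qed

lemma scalar_add: "scalar (a + b) = scalar a + scalar b"
  by transfer (simp add: single_add)

lemma scalar_mult: "scalar (a * b) = scalar a * scalar b"
  by transfer (simp add: mult_single)

lemma scalar_0 [simp]: "scalar 0 = 0" and scalar_1 [simp]: "scalar 1 = 1"
  by (transfer; simp)+

lemma scalar_uminus: "scalar (- a) = - scalar a"
  using scalar_add[of a "- a"] by (simp add: eq_neg_iff_add_eq_0 add.commute)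

lemma scalar_diff: "scalar (a - b) = scalar a - scalar b"
  using scalar_add[of a "- b"] by (simp add: scalar_uminus)

lemma scalar_sum: "scalar (sum f A) = (\<Sum>a\<in>A. scalar (f a))"
  by (induction A rule: infinite_finite_induct) (auto simp: scalar_add)

lemma berezin_0 [simp]: "berezin 0 = 0"
  by transfer simp

lemma berezin_add: "berezin (f + g) = berezin f + berezin g"
  by transfer (simp add: poly_trace_add)

lemma berezin_uminus: "berezin (- f) = - berezin f"
  by transfer (simp add: poly_trace_uminus)

lemma berezin_diff: "berezin (f - g) = berezin f - berezin g"
  using berezin_add[of f "- g"] by (simp add: berezin_uminus)

lemma berezin_sum: "berezin (sum f A) = (\<Sum>a\<in>A. berezin (f a))"
  by (induction A rule: infinite_finite_induct) (auto simp: berezin_add)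

lemma berezin_scalar: "berezin (scalar c * f) = c * berezin f"
  by transfer (simp add: poly_trace_scale)

lemma berezin_gens: "berezin (\<Prod>p\<leftarrow>v. gen p) = of_int (alt_trace v)"
proof -
  have "(\<Prod>p\<leftarrow>v. gen p) = abs_minor_alg (Poly_Mapping.single (mset v) (1::'a))"
    by (induction v)
       (simp_all add: one_minor_alg_def gen.abs_eq times_minor_alg.abs_eq mult_single add_mset_commute)
  then show ?thesis by (simp add: berezin.abs_eq)
qed

text \<open>Characteristic 0 provides the scalar 1/2. The lemma serves to kill sums that a
  reindexing turns into their negatives.\<close>

lemma zero_if_eq_uminus:
  assumes "f = - (f :: 'a::field_char_0 minor_alg)"
  shows "f = 0"
proof -
  have "f + f = 0" using assms by (metis add.right_inverse)
  moreover have "f = (scalar (1/2) + scalar (1/2)) * f"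
    by (simp flip: scalar_add)
  then have "f = scalar (1/2) * (f + f)" by (simp add: algebra_simps)
  ultimately show ?thesis by simp
qed

subsection \<open>The generic matrix of sp(2n)\<close>

definition rsgn :: "nat \<Rightarrow> nat \<Rightarrow> 'a::field_char_0 minor_alg" where
  "rsgn n i = scalar (eps n i)"

lemma rsgn_sq [simp]: "rsgn n i * rsgn n i = 1" "rsgn n i * (rsgn n i * f) = f"
  by (simp_all add: rsgn_def mult.assoc[symmetric] scalar_mult[symmetric])

lemma rsgn_prime_idx: "i < 2 * n \<Longrightarrow> rsgn n (prime_idx n i) = - rsgn n i"
  by (simp add: rsgn_def prime_idx scalar_uminus)

lemma sum_prime_idx: "(\<Sum>i<2*n. f (prime_idx n i)) = (\<Sum>i<2*n. f i)"
proof -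
  have "bij_betw (prime_idx n) {..<2*n} {..<2*n}"
    by (rule bij_betwI[where g = "prime_idx n"]) (auto simp: prime_idx)
  then show ?thesis by (rule sum.reindex_bij_betw)
qed

text \<open>Minus the symplectic transpose of the matrix of generators. Adding it projects that
  matrix to sp(2n), up to a factor 2.\<close>

definition dual_gen :: "nat \<Rightarrow> pos \<Rightarrow> 'a::field_char_0 minor_alg" where
  "dual_gen n = (\<lambda>(i, j). - (rsgn n i * rsgn n j * gen (prime_idx n j, prime_idx n i)))"

(* omega n (a, b) is the (a, b)-entry of the sum of gen (i, j) times F_elt n i j, see omega_expand. *)
definition omega :: "nat \<Rightarrow> pos \<Rightarrow> 'a::field_char_0 minor_alg" where
  "omega n p = gen p + dual_gen n p"

definition theta :: "nat \<Rightarrow> 'a::field_char_0 minor_alg" where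
  "theta n = (\<Sum>i<2*n. gen (i, i))"

text \<open>In the anticommuting variables this is, up to sign, the product of the symplectic
  quadratic form in the \<psi>' and that in the \<psi>. The product, unlike its factors, is
  expressible in the generators.\<close>

definition tau :: "nat \<Rightarrow> 'a::field_char_0 minor_alg" where
  "tau n = (\<Sum>i<2*n. \<Sum>j<2*n. rsgn n i * rsgn n j * (gen (i, j) * gen (prime_idx n i, prime_idx n j)))"

definition casimir :: "nat \<Rightarrow> 'a::field_char_0 minor_alg" where
  "casimir n = theta n * theta n + tau n"

text \<open>A repeated inner index splits off as a diagonal generator, so that summing over k yields
  - \<theta>. For \<open>dual_gen\<close> the sign is opposite; this difference makes mixed terms of
  the cube cancel.\<close>

lemma gen_gen: "gen (a, k) * gen (k, l) = - (gen (k, k) * gen (a, l))"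
  by (subst gen_exchange) (simp add: mult.commute)

lemma dual_gen_dual_gen:
  "dual_gen n (a, k) * dual_gen n (k, l)
    = gen (prime_idx n k, prime_idx n k) * dual_gen n (a, l)"
proof -
  let ?p = "prime_idx n"
  have "dual_gen n (a, k) * dual_gen n (k, l)
      = rsgn n k * rsgn n k * (rsgn n a * rsgn n l * (gen (?p k, ?p a) * gen (?p l, ?p k)))"
    unfolding dual_gen_def by (simp only: case_prod_conv ac_simps minus_mult_minus)
  also have "\<dots> = - (rsgn n a * rsgn n l * (gen (?p k, ?p k) * gen (?p l, ?p a)))"
    by (subst gen_exchange) simp
  finally show ?thesis by (simp add: dual_gen_def ac_simps)
qed

text \<open>Exchanging the indices of the two outer factors frees \<open>gen (a, b)\<close>, and
  what remains is the summand of \<open>tau\<close> at (l, k).\<close>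

lemma gen_dual_gen_gen:
  "gen (a, k) * dual_gen n (k, l) * gen (l, b)
    = rsgn n l * rsgn n k * (gen (l, k) * gen (prime_idx n l, prime_idx n k)) * gen (a, b)"
proof -
  let ?p = "prime_idx n"
  have "gen (a, k) * dual_gen n (k, l) * gen (l, b)
      = - (rsgn n l * rsgn n k * gen (?p l, ?p k) * (gen (a, k) * gen (l, b)))"
    by (simp add: dual_gen_def ac_simps)
  also have "\<dots> = rsgn n l * rsgn n k * gen (?p l, ?p k) * (gen (a, b) * gen (l, k))"
    by (subst gen_exchange) simp
  finally show ?thesis by (simp add: ac_simps)
qed

lemma dual_gen_gen_dual_gen:
  "dual_gen n (a, k) * gen (k, l) * dual_gen n (l, b)
    = rsgn n k * rsgn n l * (gen (k, l) * gen (prime_idx n k, prime_idx n l)) * dual_gen n (a, b)"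
proof -
  let ?p = "prime_idx n"
  have "dual_gen n (a, k) * gen (k, l) * dual_gen n (l, b)
      = rsgn n k * rsgn n l * rsgn n a * rsgn n b * gen (k, l)
        * (gen (?p k, ?p a) * gen (?p b, ?p l))"
    unfolding dual_gen_def by (simp only: case_prod_conv ac_simps minus_mult_left[symmetric] minus_mult_right[symmetric] minus_minus)
  also have "\<dots> = - (rsgn n k * rsgn n l * rsgn n a * rsgn n b * gen (k, l)
        * (gen (?p k, ?p l) * gen (?p b, ?p a)))"
    by (subst gen_exchange) simp
  finally show ?thesis by (simp add: dual_gen_def ac_simps)
qed

text \<open>Writing \<Omega> = z + d gives eight triple products. By zz = - \<theta> z and dd =
  \<theta> d, the products zzz and ddd carry \<theta>^2, while zdz and dzd carry \<tau>. The other
  four cancel in the pairs zzd, zdd and dzz, ddz.\<close>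

lemma omega_cube:
  "(\<Sum>k<2*n. \<Sum>l<2*n. omega n (a, k) * omega n (k, l) * omega n (l, b)) = casimir n * omega n (a, b)"
proof -
  let ?N = "2*n" and ?z = "gen :: pos \<Rightarrow> 'a minor_alg" and ?d = "dual_gen n :: pos \<Rightarrow> 'a minor_alg"
    and ?p = "prime_idx n"
  define A B where "A = (\<Sum>l<?N. ?z (a, l) * ?d (l, b))" and "B = (\<Sum>l<?N. ?d (a, l) * ?z (l, b))"
  have theta': "(\<Sum>k<?N. ?z (?p k, ?p k)) = theta n"
    unfolding theta_def by (rule sum_prime_idx)
  have prod: "(\<Sum>k<?N. \<Sum>l<?N. f k * g l) = sum f {..<?N} * sum g {..<?N}" for f g :: "nat \<Rightarrow> 'a minor_alg"
    by (simp add: sum_product)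
  have zzz: "(\<Sum>k<?N. \<Sum>l<?N. ?z (a, k) * ?z (k, l) * ?z (l, b)) = theta n * theta n * ?z (a, b)"
  proof -
    have "?z (a, k) * ?z (k, l) * ?z (l, b) = ?z (k, k) * (?z (l, l) * ?z (a, b))" for k l
      unfolding gen_gen[of a k l] by (simp add: mult.assoc gen_gen[of a l b])
    then show ?thesis by (simp add: prod sum_distrib_right[symmetric] mult.assoc theta_def)
  qed
  have zzd: "(\<Sum>k<?N. \<Sum>l<?N. ?z (a, k) * ?z (k, l) * ?d (l, b)) = - (theta n * A)"
  proof -
    have "?z (a, k) * ?z (k, l) * ?d (l, b) = - ?z (k, k) * (?z (a, l) * ?d (l, b))" for k l
      unfolding gen_gen[of a k l] by (simp add: mult.assoc)
    then show ?thesis by (simp only: prod A_def) (simp add: theta_def sum_negf)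
  qed
  have zdd: "(\<Sum>k<?N. \<Sum>l<?N. ?z (a, k) * ?d (k, l) * ?d (l, b)) = theta n * A"
  proof -
    have "?z (a, k) * ?d (k, l) * ?d (l, b) = ?z (a, k) * ?d (k, b) * ?z (?p l, ?p l)" for k l
      unfolding mult.assoc dual_gen_dual_gen[of n k l b] by (simp only: ac_simps)
    then show ?thesis by (simp only: prod A_def theta') (simp only: mult.commute)
  qed
  have dzz: "(\<Sum>k<?N. \<Sum>l<?N. ?d (a, k) * ?z (k, l) * ?z (l, b)) = - (theta n * B)"
  proof -
    have "?d (a, k) * ?z (k, l) * ?z (l, b) = ?d (a, k) * ?z (k, b) * - ?z (l, l)" for k l
      unfolding mult.assoc gen_gen[of k l b] by (simp add: ac_simps)
    then show ?thesis by (simp only: prod B_def) (simp add: theta_def sum_negf mult.commute)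
  qed
  have ddz: "(\<Sum>k<?N. \<Sum>l<?N. ?d (a, k) * ?d (k, l) * ?z (l, b)) = theta n * B"
  proof -
    have "?d (a, k) * ?d (k, l) * ?z (l, b) = ?z (?p k, ?p k) * (?d (a, l) * ?z (l, b))" for k l
      unfolding dual_gen_dual_gen[of n a k l] by (simp only: mult.assoc)
    then show ?thesis by (simp only: prod B_def theta')
  qed
  have ddd: "(\<Sum>k<?N. \<Sum>l<?N. ?d (a, k) * ?d (k, l) * ?d (l, b)) = theta n * theta n * ?d (a, b)"
  proof -
    have "?d (a, k) * ?d (k, l) * ?d (l, b) = ?z (?p k, ?p k) * (?z (?p l, ?p l) * ?d (a, b))" for k l
      unfolding dual_gen_dual_gen[of n a k l] mult.assoc dual_gen_dual_gen[of n a l b] ..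
    then show ?thesis by (simp add: prod sum_distrib_right[symmetric] mult.assoc theta')
  qed
  have zdz: "(\<Sum>k<?N. \<Sum>l<?N. ?z (a, k) * ?d (k, l) * ?z (l, b)) = tau n * ?z (a, b)"
    unfolding gen_dual_gen_gen tau_def sum_distrib_right by (rule sum.swap)
  have dzd: "(\<Sum>k<?N. \<Sum>l<?N. ?d (a, k) * ?z (k, l) * ?d (l, b)) = tau n * ?d (a, b)"
    unfolding dual_gen_gen_dual_gen tau_def sum_distrib_right ..
  have "omega n (a, k) * omega n (k, l) * omega n (l, b)
      = ?z (a, k) * ?z (k, l) * ?z (l, b) + ?z (a, k) * ?z (k, l) * ?d (l, b)
      + ?z (a, k) * ?d (k, l) * ?z (l, b) + ?z (a, k) * ?d (k, l) * ?d (l, b)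
      + ?d (a, k) * ?z (k, l) * ?z (l, b) + ?d (a, k) * ?z (k, l) * ?d (l, b)
      + ?d (a, k) * ?d (k, l) * ?z (l, b) + ?d (a, k) * ?d (k, l) * ?d (l, b)" for k l
    by (simp add: omega_def algebra_simps)
  then have "(\<Sum>k<?N. \<Sum>l<?N. omega n (a, k) * omega n (k, l) * omega n (l, b))
      = theta n * theta n * ?z (a, b) - theta n * A + tau n * ?z (a, b) + theta n * A
        - theta n * B + tau n * ?d (a, b) + theta n * B + theta n * theta n * ?d (a, b)"
    by (simp only: sum.distrib zzz zzd zdz zdd dzz dzd ddz ddd) (simp add: algebra_simps)
  then show ?thesis by (simp add: casimir_def omega_def algebra_simps)
qed

text \<open>By the exchange relation the products zxz and dxd carry the same scalar s. The mixed
  products vanish, since the reindexing (k, l) \<mapsto> (l', k') turns each mixed sum into its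
  negative.\<close>

lemma omega_sandwich:
  fixes x :: "'a::field_char_0 mat"
  assumes x: "x \<in> sp n"
  shows "(\<Sum>k<2*n. \<Sum>l<2*n. omega n (a, k) * scalar (x $$ (k, l)) * omega n (l, b))
    = - (\<Sum>k<2*n. \<Sum>l<2*n. scalar (x $$ (k, l)) * gen (l, k)) * omega n (a, b)"
proof -
  let ?N = "2*n" and ?z = "gen :: pos \<Rightarrow> 'a minor_alg" and ?d = "dual_gen n :: pos \<Rightarrow> 'a minor_alg"
    and ?p = "prime_idx n" and ?X = "\<lambda>k l. scalar (x $$ (k, l))"
  define s where "s = - (\<Sum>k<?N. \<Sum>l<?N. ?X k l * ?z (l, k))"
  have X: "?X (?p l) (?p k) = - (rsgn n k * rsgn n l * ?X k l)" if "k < ?N" "l < ?N" for k l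
    using x that by (simp add: sp_iff rsgn_def scalar_mult scalar_uminus)
  \<comment> \<open>The reindexing (k, l) \<mapsto> (l', k'), under which the entries of x in sp(2n)
    change only by the signs in \<open>X\<close>.\<close>
  have flip: "(\<Sum>k<?N. \<Sum>l<?N. f k l) = (\<Sum>k<?N. \<Sum>l<?N. f (?p l) (?p k))"
    for f :: "nat \<Rightarrow> nat \<Rightarrow> 'a minor_alg"
    by (subst sum.swap) (simp add: sum_prime_idx[of "\<lambda>k. f _ k"] sum_prime_idx[of "\<lambda>k. sum (f k) _"]
      sum_prime_idx[of "\<lambda>l. \<Sum>k<?N. f l (?p k)"])
  have zz: "(\<Sum>k<?N. \<Sum>l<?N. ?z (a, k) * ?X k l * ?z (l, b)) = s * ?z (a, b)"
  proof -
    have "?z (a, k) * ?X k l * ?z (l, b) = - (?X k l * ?z (l, k)) * ?z (a, b)" for k l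
    proof -
      have "?z (a, k) * ?X k l * ?z (l, b) = ?X k l * (?z (a, k) * ?z (l, b))"
        by (simp only: ac_simps)
      also have "\<dots> = - (?X k l * (?z (a, b) * ?z (l, k)))"
        by (subst gen_exchange) simp
      finally show ?thesis by (simp add: ac_simps)
    qed
    then show ?thesis by (simp add: s_def sum_negf sum_distrib_right)
  qed
  have dd: "(\<Sum>k<?N. \<Sum>l<?N. ?d (a, k) * ?X k l * ?d (l, b)) = s * ?d (a, b)"
  proof -
    have "?d (a, k) * ?X k l * ?d (l, b) = - (?X (?p l) (?p k) * ?z (?p k, ?p l)) * ?d (a, b)"
      if "k < ?N" "l < ?N" for k l
    proof -
      have "?d (a, k) * ?X k l * ?d (l, b)
          = rsgn n a * rsgn n b * (rsgn n k * rsgn n l * ?X k l) * (?z (?p k, ?p a) * ?z (?p b, ?p l))"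
        unfolding dual_gen_def by (simp only: case_prod_conv ac_simps minus_mult_left[symmetric] minus_mult_right[symmetric] minus_minus)
      also have "\<dots> = - (rsgn n a * rsgn n b * (rsgn n k * rsgn n l * ?X k l) * (?z (?p k, ?p l) * ?z (?p b, ?p a)))"
        by (subst gen_exchange) simp
      finally show ?thesis unfolding X[OF that] by (simp add: dual_gen_def ac_simps)
    qed
    then have "(\<Sum>k<?N. \<Sum>l<?N. ?d (a, k) * ?X k l * ?d (l, b))
        = (\<Sum>k<?N. \<Sum>l<?N. - (?X (?p l) (?p k) * ?z (?p k, ?p l)) * ?d (a, b))"
      by (intro sum.cong refl) auto
    also have "\<dots> = (\<Sum>k<?N. \<Sum>l<?N. - (?X k l * ?z (l, k)) * ?d (a, b))"
      by (rule flip[symmetric])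
    finally show ?thesis by (simp add: s_def sum_negf sum_distrib_right)
  qed
  have zd: "(\<Sum>k<?N. \<Sum>l<?N. ?z (a, k) * ?X k l * ?d (l, b)) = 0" (is "?S = 0")
  proof (rule zero_if_eq_uminus)
    have "?z (a, ?p l) * ?X (?p l) (?p k) * ?d (?p k, b) = - (?z (a, k) * ?X k l * ?d (l, b))"
      if "k < ?N" "l < ?N" for k l
    proof -
      have "?z (a, ?p l) * ?X (?p l) (?p k) * ?d (?p k, b)
          = - (rsgn n k * rsgn n k * rsgn n l * rsgn n b * ?X k l * (?z (a, ?p l) * ?z (?p b, k)))"
        unfolding X[OF that] dual_gen_def using that by (simp add: rsgn_prime_idx prime_idx ac_simps)
      also have "\<dots> = rsgn n l * rsgn n b * ?X k l * (?z (a, k) * ?z (?p b, ?p l))"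
        by (subst gen_exchange) simp
      finally show ?thesis by (simp add: dual_gen_def ac_simps)
    qed
    then have "(\<Sum>k<?N. \<Sum>l<?N. ?z (a, ?p l) * ?X (?p l) (?p k) * ?d (?p k, b))
        = (\<Sum>k<?N. \<Sum>l<?N. - (?z (a, k) * ?X k l * ?d (l, b)))"
      by (intro sum.cong refl) auto
    then show "?S = - ?S" by (subst flip) (simp add: sum_negf)
  qed
  have dz: "(\<Sum>k<?N. \<Sum>l<?N. ?d (a, k) * ?X k l * ?z (l, b)) = 0" (is "?S = 0")
  proof (rule zero_if_eq_uminus)
    have "?d (a, ?p l) * ?X (?p l) (?p k) * ?z (?p k, b) = - (?d (a, k) * ?X k l * ?z (l, b))"
      if "k < ?N" "l < ?N" for k l
    proof -
      have "?d (a, ?p l) * ?X (?p l) (?p k) * ?z (?p k, b)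
          = - (rsgn n l * rsgn n l * rsgn n k * rsgn n a * ?X k l * (?z (l, ?p a) * ?z (?p k, b)))"
        unfolding X[OF that] dual_gen_def using that by (simp add: rsgn_prime_idx prime_idx ac_simps)
      also have "\<dots> = rsgn n k * rsgn n a * ?X k l * (?z (l, b) * ?z (?p k, ?p a))"
        by (subst gen_exchange) simp
      finally show ?thesis by (simp add: dual_gen_def ac_simps)
    qed
    then have "(\<Sum>k<?N. \<Sum>l<?N. ?d (a, ?p l) * ?X (?p l) (?p k) * ?z (?p k, b))
        = (\<Sum>k<?N. \<Sum>l<?N. - (?d (a, k) * ?X k l * ?z (l, b)))"
      by (intro sum.cong refl) auto
    then show "?S = - ?S" by (subst flip) (simp add: sum_negf)
  qed
  have "omega n (a, k) * ?X k l * omega n (l, b)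
      = ?z (a, k) * ?X k l * ?z (l, b) + ?z (a, k) * ?X k l * ?d (l, b)
      + ?d (a, k) * ?X k l * ?z (l, b) + ?d (a, k) * ?X k l * ?d (l, b)" for k l
    by (simp add: omega_def algebra_simps)
  then have "(\<Sum>k<?N. \<Sum>l<?N. omega n (a, k) * ?X k l * omega n (l, b)) = s * omega n (a, b)"
    by (simp only: sum.distrib zz zd dz dd) (simp add: omega_def algebra_simps)
  then show ?thesis by (simp add: s_def)
qed

section \<open>Commutators over a commutative ring and the cubic relation for ad \<Omega>\<close>

definition bracket :: "'b::comm_ring_1 mat \<Rightarrow> 'b mat \<Rightarrow> 'b mat" where
  "bracket A B = A * B - B * A"

lemma bracket_carrier [simp]:
  "A \<in> carrier_mat N N \<Longrightarrow> B \<in> carrier_mat N N \<Longrightarrow> bracket A B \<in> carrier_mat N N"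
  unfolding bracket_def by (intro minus_carrier_mat mult_carrier_mat)

lemma bracket_index:
  assumes "A \<in> carrier_mat N N" "B \<in> carrier_mat N N" "i < N" "j < N"
  shows "bracket A B $$ (i, j) = (\<Sum>k<N. A $$ (i, k) * B $$ (k, j) - B $$ (i, k) * A $$ (k, j))"
  using assms by (auto simp: bracket_def scalar_prod_def sum_subtractf lessThan_atLeast0)

lemma bracket_smult:
  assumes "A \<in> carrier_mat N N" "B \<in> carrier_mat N N"
  shows "bracket A (c \<cdot>\<^sub>m B) = c \<cdot>\<^sub>m bracket A B"
proof (rule eq_matI)
  fix i j assume "i < dim_row (c \<cdot>\<^sub>m bracket A B)" "j < dim_col (c \<cdot>\<^sub>m bracket A B)"
  then have ij: "i < N" "j < N" using assms by (auto simp: bracket_def)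
  then show "bracket A (c \<cdot>\<^sub>m B) $$ (i, j) = (c \<cdot>\<^sub>m bracket A B) $$ (i, j)"
    using assms bracket_index[of A N "c \<cdot>\<^sub>m B" i j] bracket_index[of A N B i j]
      carrier_matD[OF bracket_carrier[OF assms]]
    by (simp add: sum_distrib_left algebra_simps)
qed (use assms in \<open>auto simp: bracket_def\<close>)

text \<open>In A^3 X - 3 A^2 X A + 3 A X A^2 - X A^3 both middle products equal s A^2 and cancel,
  and A^3 = c A turns the outer ones into c (A X - X A).\<close>

lemma bracket_cube:
  fixes A X :: "'b::comm_ring_1 mat"
  assumes A: "A \<in> carrier_mat N N" and X: "X \<in> carrier_mat N N"
    and cube: "A * A * A = c \<cdot>\<^sub>m A" and sandwich: "A * X * A = s \<cdot>\<^sub>m A"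
  shows "bracket A (bracket A (bracket A X)) = c \<cdot>\<^sub>m bracket A X"
proof -
  define P Q R S B where "P = A * X" and "Q = X * A" and "R = A * P" and "S = Q * A" and "B = A * A"
  have carrier [simp]: "P \<in> carrier_mat N N" "Q \<in> carrier_mat N N" "R \<in> carrier_mat N N"
    "S \<in> carrier_mat N N" "B \<in> carrier_mat N N"
    using A X by (auto simp: P_def Q_def R_def S_def B_def)
  note assoc = assoc_mult_mat[where n\<^sub>1 = N and n\<^sub>2 = N and n\<^sub>3 = N and n\<^sub>4 = N]
  note distrib = mult_minus_distrib_mat[where nr = N and n = N and nc = N]
    minus_mult_distrib_mat[where nr = N and n = N and nc = N]
  have AQ: "A * Q = s \<cdot>\<^sub>m A" and PA: "P * A = s \<cdot>\<^sub>m A"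
    unfolding P_def Q_def sandwich[symmetric] using A X by (simp_all add: assoc)
  have AsA: "A * (s \<cdot>\<^sub>m A) = s \<cdot>\<^sub>m B" and sAA: "s \<cdot>\<^sub>m A * A = s \<cdot>\<^sub>m B"
    unfolding B_def by (rule mult_smult_distrib[OF A A] mult_smult_assoc_mat[OF A A])+
  have "A * R = A * A * A * X" using A X by (simp add: R_def P_def assoc)
  then have AR: "A * R = c \<cdot>\<^sub>m P"
    unfolding cube P_def by (simp add: mult_smult_assoc_mat[OF A X])
  have "A * S = A * Q * A" using A by (simp add: S_def assoc)
  then have AS: "A * S = s \<cdot>\<^sub>m B" by (simp add: AQ sAA)
  have "R * A = A * (P * A)" using A by (simp add: R_def assoc)
  then have RA: "R * A = s \<cdot>\<^sub>m B" by (simp add: PA AsA)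
  have "S * A = X * (A * A * A)" using A X by (simp add: S_def Q_def assoc)
  then have SA: "S * A = c \<cdot>\<^sub>m Q"
    unfolding cube Q_def by (simp add: mult_smult_distrib[OF X A])
  have two: "bracket A (P - Q) = (R - s \<cdot>\<^sub>m A) - (s \<cdot>\<^sub>m A - S)"
    using A by (simp add: bracket_def distrib AQ PA flip: R_def S_def)
  have "bracket A (bracket A (P - Q))
      = ((c \<cdot>\<^sub>m P - s \<cdot>\<^sub>m B) - (s \<cdot>\<^sub>m B - s \<cdot>\<^sub>m B)) - ((s \<cdot>\<^sub>m B - s \<cdot>\<^sub>m B) - (s \<cdot>\<^sub>m B - c \<cdot>\<^sub>m Q))"
    unfolding two using A by (simp add: bracket_def distrib AR AS RA SA AsA sAA minus_carrier_mat)
  also have "\<dots> = c \<cdot>\<^sub>m (P - Q)"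
    by (intro eq_matI)
       (auto simp: algebra_simps carrier[THEN carrier_matD(1)] carrier[THEN carrier_matD(2)])
  finally show ?thesis by (simp add: bracket_def P_def Q_def)
qed

definition Omega :: "nat \<Rightarrow> 'a::field_char_0 minor_alg mat" where
  "Omega n = mat (2*n) (2*n) (omega n)"

lemma Omega_carrier [simp]: "Omega n \<in> carrier_mat (2*n) (2*n)"
  by (simp add: Omega_def)

lemma Omega_index: "i < 2*n \<Longrightarrow> j < 2*n \<Longrightarrow> Omega n $$ (i, j) = omega n (i, j)"
  by (simp add: Omega_def)

lemma Omega_bracket_cube:
  fixes x :: "'a::field_char_0 mat"
  assumes x: "x \<in> sp n"
  shows "bracket (Omega n) (bracket (Omega n) (bracket (Omega n) (map_mat scalar x)))
    = casimir n \<cdot>\<^sub>m bracket (Omega n) (map_mat scalar x)"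
proof (rule bracket_cube)
  let ?N = "2*n"
  show "map_mat scalar x \<in> carrier_mat ?N ?N" using sp_carrier[OF x] by simp
  have triple: "(A * B * C) $$ (i, j) = (\<Sum>k<?N. \<Sum>l<?N. A $$ (i, k) * B $$ (k, l) * C $$ (l, j))"
    if "A \<in> carrier_mat ?N ?N" "B \<in> carrier_mat ?N ?N" "C \<in> carrier_mat ?N ?N" "i < ?N" "j < ?N"
    for A B C :: "'a minor_alg mat" and i j
    using that by (simp add: scalar_prod_def lessThan_atLeast0 sum_distrib_left mult.assoc)
  show "Omega n * Omega n * Omega n = casimir n \<cdot>\<^sub>m (Omega n :: 'a minor_alg mat)"
  proof (rule eq_matI)
    fix i j assume "i < dim_row (casimir n \<cdot>\<^sub>m (Omega n :: 'a minor_alg mat))"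
      "j < dim_col (casimir n \<cdot>\<^sub>m (Omega n :: 'a minor_alg mat))"
    then have ij: "i < ?N" "j < ?N" by (auto simp: Omega_def)
    have "(Omega n * Omega n * (Omega n :: 'a minor_alg mat)) $$ (i, j)
        = (\<Sum>k<?N. \<Sum>l<?N. omega n (i, k) * omega n (k, l) * omega n (l, j))"
      using ij by (subst triple) (auto simp: Omega_index intro!: sum.cong)
    then show "(Omega n * Omega n * (Omega n :: 'a minor_alg mat)) $$ (i, j)
        = (casimir n \<cdot>\<^sub>m Omega n) $$ (i, j)"
      using ij by (simp add: omega_cube Omega_def)
  qed (auto simp: Omega_def)
  show "Omega n * map_mat scalar x * Omega n
      = (- (\<Sum>k<?N. \<Sum>l<?N. scalar (x $$ (k, l)) * gen (l, k))) \<cdot>\<^sub>m Omega n" (is "_ = ?s \<cdot>\<^sub>m _")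
  proof (rule eq_matI)
    fix i j assume "i < dim_row (?s \<cdot>\<^sub>m Omega n)" "j < dim_col (?s \<cdot>\<^sub>m Omega n)"
    then have ij: "i < ?N" "j < ?N" by (auto simp: Omega_def)
    have "(Omega n * map_mat scalar x * Omega n) $$ (i, j)
        = (\<Sum>k<?N. \<Sum>l<?N. omega n (i, k) * scalar (x $$ (k, l)) * omega n (l, j))"
      using ij sp_carrier[OF x] by (subst triple) (auto simp: Omega_index intro!: sum.cong)
    then show "(Omega n * map_mat scalar x * Omega n) $$ (i, j) = (?s \<cdot>\<^sub>m Omega n) $$ (i, j)"
      using ij by (simp add: omega_sandwich[OF x] Omega_def)
  qed (auto simp: Omega_def)
qed simp

subsection \<open>Integration by parts against the Casimir element\<close>

(* Berezin integration by parts moves the factor \<psi>'_i \<psi>_j = gen (i, j) onto the rest of the integrand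
   as the derivation sending \<psi>'_j to \<psi>'_i: dgen, dgens, domega and domegas are its values on
   generators, on words, on the entries of Omega and on products of such entries. *)
definition dgen :: "nat \<Rightarrow> nat \<Rightarrow> pos \<Rightarrow> 'a::field_char_0 minor_alg" where
  "dgen i j = (\<lambda>(k, l). of_bool (j = k) * gen (i, l))"

fun dgens :: "nat \<Rightarrow> nat \<Rightarrow> pos list \<Rightarrow> 'a::field_char_0 minor_alg" where
  "dgens i j [] = 0"
| "dgens i j (p # v) = dgen i j p * (\<Prod>q\<leftarrow>v. gen q) + gen p * dgens i j v"

lemma dgens_eq_sum:
  "dgens i j v = (\<Sum>b<length v. of_bool (j = fst (v ! b)) * (\<Prod>q\<leftarrow>v[b := (i, snd (v ! b))]. gen q))"
proof (induction v)
  case (Cons p v)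
  show ?case
    by (cases p)
       (simp add: Cons.IH dgen_def sum.lessThan_Suc_shift sum_distrib_left mult.left_commute mult.assoc
         del: sum.lessThan_Suc sum_of_bool_mult_eq sum_mult_of_bool_eq)
qed simp

text \<open>Permutation invariance moves the letter (i, j) to the end of the word, where the row
  expansion yields the boundary term and the derivation.\<close>

lemma berezin_gen_gens:
  "berezin (gen (i, j) * (\<Prod>q\<leftarrow>v. gen q))
    = of_bool (i = j) * berezin (\<Prod>q\<leftarrow>v. gen q) - berezin (dgens i j v)"
proof -
  have of_bool_berezin: "berezin (of_bool P * f) = of_bool P * berezin f" for P and f :: "'a minor_alg"
    by (cases P) auto
  have "berezin (gen (i, j) * (\<Prod>q\<leftarrow>v. gen q)) = (of_int (alt_trace ((i, j) # v)) :: 'a)"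
    using berezin_gens[of "(i, j) # v"] by simp
  also have "alt_trace ((i, j) # v) = alt_trace (v @ [(i, j)])"
    by (rule alt_trace_mset) simp
  finally show ?thesis
    by (simp add: alt_trace_snoc dgens_eq_sum berezin_sum of_bool_berezin berezin_gens)
qed

definition domega :: "nat \<Rightarrow> nat \<Rightarrow> nat \<Rightarrow> pos \<Rightarrow> 'a::field_char_0 minor_alg" where
  "domega n i j = (\<lambda>(k, l). dgen i j (k, l)
     - rsgn n k * rsgn n l * dgen i j (prime_idx n l, prime_idx n k))"

fun domegas :: "nat \<Rightarrow> nat \<Rightarrow> nat \<Rightarrow> pos list \<Rightarrow> 'a::field_char_0 minor_alg" where
  "domegas n i j [] = 0"
| "domegas n i j (p # ps) = domega n i j p * (\<Prod>q\<leftarrow>ps. omega n q) + omega n p * domegas n i j ps"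

text \<open>Each factor \<open>omega\<close> is a combination of two generators. The induction
  splits off one factor at a time and moves its generators into the word v, which is therefore
  arbitrary.\<close>

lemma berezin_gen_omegas:
  "berezin (gen (i, j) * ((\<Prod>q\<leftarrow>ps. omega n q) * (\<Prod>q\<leftarrow>v. gen q)))
    = of_bool (i = j) * berezin ((\<Prod>q\<leftarrow>ps. omega n q) * (\<Prod>q\<leftarrow>v. gen q))
      - berezin (domegas n i j ps * (\<Prod>q\<leftarrow>v. gen q) + (\<Prod>q\<leftarrow>ps. omega n q) * dgens i j v)"
proof (induction ps arbitrary: v)
  case Nil
  then show ?case by (simp add: berezin_gen_gens)
next
  case (Cons p ps)
  obtain k l where p: "p = (k, l)" by fastforce
  let ?p' = "(prime_idx n l, prime_idx n k)" and ?c = "- (eps n k * eps n l) :: 'a"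
  let ?O = "\<Prod>q\<leftarrow>ps. omega n q :: 'a minor_alg" and ?G = "\<Prod>q\<leftarrow>v. gen q :: 'a minor_alg"
  have om: "omega n p = gen p + scalar ?c * gen ?p'"
    by (simp add: omega_def dual_gen_def p rsgn_def scalar_uminus scalar_mult)
  have dom: "domega n i j p = dgen i j p + scalar ?c * dgen i j ?p'"
    by (simp add: domega_def p rsgn_def scalar_uminus scalar_mult)
  have split: "berezin (f * (omega n p * ?O * ?G)) = berezin (f * (?O * (gen p * ?G)))
      + ?c * berezin (f * (?O * (gen ?p' * ?G)))" for f
    unfolding om berezin_scalar[symmetric] berezin_add[symmetric]
    by (simp only: algebra_simps)
  have split1: "berezin (omega n p * ?O * ?G) = berezin (?O * (gen p * ?G))
      + ?c * berezin (?O * (gen ?p' * ?G))"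
    using split[of 1] by simp
  \<comment> \<open>By the Leibniz rule the derivation is compatible with the splitting of
    \<open>omega\<close>.\<close>
  have split_d: "berezin (domegas n i j (p # ps) * ?G + omega n p * ?O * dgens i j v)
      = berezin (domegas n i j ps * (gen p * ?G) + ?O * dgens i j (p # v))
        + ?c * berezin (domegas n i j ps * (gen ?p' * ?G) + ?O * dgens i j (?p' # v))"
    unfolding berezin_scalar[symmetric] berezin_add[symmetric] domegas.simps dgens.simps om dom
    by (simp only: algebra_simps)
  have "berezin (gen (i, j) * (omega n p * ?O * ?G))
      = of_bool (i = j) * berezin (omega n p * ?O * ?G)
        - berezin (domegas n i j (p # ps) * ?G + omega n p * ?O * dgens i j v)"
    unfolding split split1 split_d
    using Cons.IH[of "p # v"] Cons.IH[of "?p' # v"]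
    by (simp only: list.map prod_list.Cons) (simp only: algebra_simps)
  then show ?case by (simp only: list.map prod_list.Cons)
qed

section \<open>Integrals of \<theta>, \<tau> and the Casimir element against entries of
  \<Omega>\<close>

lemma sum_of_bool_left:
  assumes "i < (m::nat)"
  shows "(\<Sum>j<m. of_bool (j = i) * f j) = (f i :: 'b::comm_semiring_1)"
  using assms by (simp add: of_bool_def if_distrib[of "\<lambda>x. x * _"] cong: if_cong)

text \<open>Summed over i = j, the derivations form the Euler operator that counts the variables
  \<psi>'. Generators and entries of \<Omega> have degree 1.\<close>

lemma sum_dgen:
  assumes "fst p < m"
  shows "(\<Sum>i<m. dgen i i p) = gen p"
  using assms by (cases p) (simp add: dgen_def sum_of_bool_left[of _ _ "\<lambda>i. gen (i, _)"])

lemma sum_dgens: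
  assumes "fst ` set v \<subseteq> {..<m}"
  shows "(\<Sum>i<m. dgens i i v) = of_nat (length v) * (\<Prod>q\<leftarrow>v. gen q)"
  using assms
proof (induction v)
  case (Cons p v)
  then show ?case
    by (simp add: sum.distrib sum_distrib_left[symmetric] sum_distrib_right[symmetric] sum_dgen algebra_simps)
qed simp

lemma sum_domega:
  assumes "p \<in> {..<2*n} \<times> {..<2*n}"
  shows "(\<Sum>i<2*n. domega n i i p) = omega n p"
  using assms
  by (cases p) (auto simp: domega_def sum_subtractf sum_distrib_left[symmetric] sum_dgen prime_idx
      omega_def dual_gen_def)

lemma sum_domegas:
  assumes "set ps \<subseteq> {..<2*n} \<times> {..<2*n}"
  shows "(\<Sum>i<2*n. domegas n i i ps) = of_nat (length ps) * (\<Prod>q\<leftarrow>ps. omega n q)"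
  using assms
proof (induction ps)
  case (Cons p ps)
  then show ?case
    by (simp add: sum.distrib sum_distrib_left[symmetric] sum_distrib_right[symmetric] sum_domega)
       (simp add: algebra_simps)
qed simp

lemma berezin_of_nat: "berezin (of_nat m * f) = of_nat m * berezin f"
  by (induction m) (simp_all add: berezin_add distrib_right)

text \<open>Summing integration by parts over i = j gives 2n from the boundary terms and subtracts
  the degree of f. The word v makes room for a summand of a second factor \<theta>.\<close>

lemma berezin_theta:
  fixes n :: nat and ps v :: "pos list"
  defines "f \<equiv> (\<Prod>q\<leftarrow>ps. omega n q) * (\<Prod>q\<leftarrow>v. gen q) :: 'a::field_char_0 minor_alg"
  assumes ps: "set ps \<subseteq> {..<2*n} \<times> {..<2*n}" and v: "fst ` set v \<subseteq> {..<2*n}"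
  shows "berezin (theta n * f) = (of_nat (2*n) - of_nat (length ps) - of_nat (length v)) * berezin f"
proof -
  let ?O = "\<Prod>q\<leftarrow>ps. omega n q :: 'a minor_alg" and ?G = "\<Prod>q\<leftarrow>v. gen q :: 'a minor_alg"
  have "berezin (theta n * f) = (\<Sum>i<2*n. berezin (gen (i, i) * (?O * ?G)))"
    by (simp add: theta_def f_def sum_distrib_right berezin_sum)
  also have "\<dots> = of_nat (2*n) * berezin f
      - berezin ((\<Sum>i<2*n. domegas n i i ps) * ?G + ?O * (\<Sum>i<2*n. dgens i i v))"
    unfolding berezin_gen_omegas f_def
    by (simp add: sum_subtractf sum.distrib berezin_add berezin_sum sum_distrib_left sum_distrib_right)
  also have "(\<Sum>i<2*n. domegas n i i ps) * ?G + ?O * (\<Sum>i<2*n. dgens i i v)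
      = of_nat (length ps) * f + of_nat (length v) * f"
    unfolding sum_domegas[OF ps] sum_dgens[OF v] f_def by (simp add: algebra_simps)
  finally show ?thesis by (simp only: berezin_add berezin_of_nat) (simp add: algebra_simps)
qed

text \<open>The sl(2)-invariance of the entries of \<Omega>, in the form in which it arises when
  \<tau> is integrated by parts. For each fixed i the two halves of \<open>domega\<close> contribute
  one term each, and these cancel by the exchange relation.\<close>

lemma sum_rsgn_gen_domega:
  assumes "p \<in> {..<2*n} \<times> {..<2*n}"
  shows "(\<Sum>i<2*n. \<Sum>j<2*n. rsgn n i * rsgn n j * (gen (prime_idx n i, prime_idx n j) * domega n i j p)) = 0"
proof -
  let ?p = "prime_idx n"
  obtain k l where p: "p = (k, l)" and kl: "k < 2*n" "l < 2*n" using assms by auto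
  have "(\<Sum>j<2*n. rsgn n i * rsgn n j * (gen (?p i, ?p j) * domega n i j p)) = (0 :: 'a minor_alg)"
    if "i < 2*n" for i
  proof -
    have "(\<Sum>j<2*n. rsgn n i * rsgn n j * (gen (?p i, ?p j) * domega n i j p))
        = (\<Sum>j<2*n. of_bool (j = k) * (rsgn n i * rsgn n j * (gen (?p i, ?p j) * gen (i, l))))
        - (\<Sum>j<2*n. of_bool (j = ?p l) * (rsgn n i * rsgn n j * rsgn n k * rsgn n l * (gen (?p i, ?p j) * gen (i, ?p k))))"
      unfolding sum_subtractf[symmetric]
      by (intro sum.cong refl) (simp add: domega_def dgen_def p algebra_simps)
    also have "\<dots> = rsgn n i * rsgn n k * (gen (?p i, ?p k) * gen (i, l))
        - rsgn n i * rsgn n (?p l) * rsgn n k * rsgn n l * (gen (?p i, ?p (?p l)) * gen (i, ?p k))"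
      using kl by (simp add: sum_of_bool_left prime_idx)
    also have "\<dots> = rsgn n i * rsgn n k * (gen (?p i, ?p k) * gen (i, l))
        + rsgn n i * rsgn n k * (gen (?p i, l) * gen (i, ?p k))"
      using kl by (simp add: rsgn_prime_idx prime_idx ac_simps)
    also have "\<dots> = 0"
      by (subst gen_exchange) simp
    finally show ?thesis .
  qed
  then show ?thesis by simp
qed

lemma sum_rsgn_gen_domegas:
  assumes "set ps \<subseteq> {..<2*n} \<times> {..<2*n}"
  shows "(\<Sum>i<2*n. \<Sum>j<2*n. rsgn n i * rsgn n j * (gen (prime_idx n i, prime_idx n j) * domegas n i j ps)) = 0"
  using assms
proof (induction ps)
  case (Cons p ps)
  let ?c = "\<lambda>i j. rsgn n i * rsgn n j :: 'a minor_alg" and ?g = "\<lambda>i j. gen (prime_idx n i, prime_idx n j)"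
  have "(\<Sum>i<2*n. \<Sum>j<2*n. ?c i j * (?g i j * domegas n i j (p # ps)))
      = (\<Sum>i<2*n. \<Sum>j<2*n. ?c i j * (?g i j * domega n i j p)) * (\<Prod>q\<leftarrow>ps. omega n q)
        + omega n p * (\<Sum>i<2*n. \<Sum>j<2*n. ?c i j * (?g i j * domegas n i j ps))"
    unfolding sum_distrib_left sum_distrib_right sum.distrib[symmetric]
    by (intro sum.cong refl) (simp add: algebra_simps)
  then show ?case using Cons by (simp add: sum_rsgn_gen_domega)
qed simp

text \<open>Integrating \<open>gen (i, j)\<close> by parts leaves three terms. The boundary term
  gives \<theta>, the derivative of f vanishes by invariance, and the derivative of the other
  generator survives only for j = i', where \<epsilon>_i \<epsilon>_j = -1 makes it a second
  \<theta>.\<close>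

lemma berezin_tau:
  fixes n :: nat and ps :: "pos list"
  defines "f \<equiv> \<Prod>q\<leftarrow>ps. omega n q :: 'a::field_char_0 minor_alg"
  assumes ps: "set ps \<subseteq> {..<2*n} \<times> {..<2*n}"
  shows "berezin (tau n * f) = 2 * berezin (theta n * f)"
proof -
  let ?p = "prime_idx n" and ?c = "\<lambda>i j. rsgn n i * rsgn n j :: 'a minor_alg"
  have expand: "berezin (?c i j * (gen (i, j) * gen (?p i, ?p j)) * f)
      = of_bool (j = i) * berezin (?c i j * (f * gen (?p i, ?p j)))
      - berezin (?c i j * (gen (?p i, ?p j) * domegas n i j ps))
      - of_bool (j = ?p i) * berezin (?c i j * (f * gen (i, ?p j)))" for i j
  proof -
    have c: "?c i j = scalar (eps n i * eps n j)" by (simp add: rsgn_def scalar_mult)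
    have "berezin (gen (i, j) * (f * gen (?p i, ?p j))) = of_bool (i = j) * berezin (f * gen (?p i, ?p j))
        - berezin (domegas n i j ps * gen (?p i, ?p j) + f * dgen i j (?p i, ?p j))"
      using berezin_gen_omegas[of i j n ps "[(?p i, ?p j)]"] by (simp add: f_def)
    moreover have "berezin (f * dgen i j (?p i, ?p j)) = of_bool (j = ?p i) * berezin (f * gen (i, ?p j))"
      by (simp add: dgen_def)
    ultimately have E: "berezin (gen (i, j) * (f * gen (?p i, ?p j))) = of_bool (j = i) * berezin (f * gen (?p i, ?p j))
        - berezin (gen (?p i, ?p j) * domegas n i j ps) - of_bool (j = ?p i) * berezin (f * gen (i, ?p j))"
      by (simp add: berezin_add eq_commute[of i j] mult.commute[of "domegas n i j ps"])
    have "berezin (?c i j * (gen (i, j) * (f * gen (?p i, ?p j))))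
      = of_bool (j = i) * berezin (?c i j * (f * gen (?p i, ?p j)))
      - berezin (?c i j * (gen (?p i, ?p j) * domegas n i j ps))
      - of_bool (j = ?p i) * berezin (?c i j * (f * gen (i, ?p j)))"
      unfolding c berezin_scalar E by (simp only: algebra_simps)
    then show ?thesis by (simp only: ac_simps)
  qed
  have "berezin (tau n * f)
      = (\<Sum>i<2*n. \<Sum>j<2*n. berezin (?c i j * (gen (i, j) * gen (?p i, ?p j)) * f))"
    by (simp add: tau_def sum_distrib_right berezin_sum)
  also have "\<dots> = (\<Sum>i<2*n. \<Sum>j<2*n. of_bool (j = i) * berezin (?c i j * (f * gen (?p i, ?p j))))
      - berezin (\<Sum>i<2*n. \<Sum>j<2*n. ?c i j * (gen (?p i, ?p j) * domegas n i j ps))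
      - (\<Sum>i<2*n. \<Sum>j<2*n. of_bool (j = ?p i) * berezin (?c i j * (f * gen (i, ?p j))))"
    unfolding expand sum_subtractf berezin_sum ..
  also have "\<dots> = (\<Sum>i<2*n. berezin (f * gen (?p i, ?p i))) + (\<Sum>i<2*n. berezin (f * gen (i, i)))"
  proof -
    have "(\<Sum>j<2*n. of_bool (j = ?p i) * berezin (?c i j * (f * gen (i, ?p j)))) = - berezin (f * gen (i, i))"
      if "i < 2*n" for i
      using that by (simp add: sum_of_bool_left prime_idx rsgn_prime_idx berezin_uminus)
    then show ?thesis
      unfolding sum_rsgn_gen_domegas[OF ps] by (simp add: sum_of_bool_left sum_negf)
  qed
  also have "\<dots> = 2 * (\<Sum>i<2*n. berezin (f * gen (i, i)))"
    by (simp add: sum_prime_idx[of "\<lambda>i. berezin (f * gen (i, i))"])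
  also have "(\<Sum>i<2*n. berezin (f * gen (i, i))) = berezin (theta n * f)"
    by (simp only: theta_def mult.commute[of _ f] sum_distrib_left berezin_sum)
  finally show ?thesis .
qed

text \<open>With m = 2n - p for p entries of \<Omega>, \<theta>^2 contributes m (m - 1) and \<tau>
  contributes 2 m, together m (m + 1).\<close>

lemma berezin_casimir:
  fixes n :: nat and ps :: "pos list"
  defines "f \<equiv> \<Prod>q\<leftarrow>ps. omega n q :: 'a::field_char_0 minor_alg"
  assumes ps: "set ps \<subseteq> {..<2*n} \<times> {..<2*n}"
  shows "berezin (casimir n * f)
    = (of_nat (2*n) - of_nat (length ps)) * (of_nat (2*n) - of_nat (length ps) + 1) * berezin f"
proof -
  let ?m = "of_nat (2*n) - of_nat (length ps) :: 'a"
  have theta: "berezin (theta n * f) = ?m * berezin f"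
    using berezin_theta[OF ps, of "[]"] by (simp add: f_def)
  have "berezin (theta n * theta n * f) = (\<Sum>i<2*n. berezin (theta n * (f * gen (i, i))))"
    by (simp only: berezin_sum[symmetric] sum_distrib_left[symmetric] theta_def[symmetric]) (simp only: ac_simps)
  \<comment> \<open>The summand \<open>gen (i, i)\<close> of one factor \<theta> raises the degree
    by one, whence m - 1 instead of m.\<close>
  also have "\<dots> = (\<Sum>i<2*n. (?m - 1) * berezin (f * gen (i, i)))"
    using berezin_theta[OF ps, where 'a = 'a and v = "[(i, i)]" for i]
    by (intro sum.cong refl) (simp add: f_def)
  also have "\<dots> = (?m - 1) * berezin (theta n * f)"
    by (simp only: theta_def mult.commute[of _ f] sum_distrib_left berezin_sum)
  finally show ?thesis
    using berezin_tau[OF ps, where 'a = 'a]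
    by (simp add: casimir_def distrib_right berezin_add theta f_def[symmetric]) (simp add: algebra_simps)
qed

subsection \<open>Symmetrising sums of principal minors\<close>

lemma prod_list_map_nth: "(\<Prod>x\<leftarrow>xs. f x) = (\<Prod>l<length xs. f (xs ! l))"
  by (simp add: prod.list_conv_set_nth lessThan_atLeast0)

text \<open>A word matched by \<sigma> is determined by its first indices f, its second indices
  being those of f \<circ> \<sigma>.\<close>

lemma sum_words_matching:
  fixes g :: "pos \<Rightarrow> 'b::comm_ring_1"
  assumes \<sigma>: "\<sigma> permutes {..<d}"
  shows "(\<Sum>v \<in> words N d. \<Prod>l<d. of_bool (snd (v ! l) = fst (v ! \<sigma> l)) * g (v ! l))
    = (\<Sum>f \<in> {..<d} \<rightarrow>\<^sub>E {..<N}. \<Prod>l<d. g (f l, f (\<sigma> l)))"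
proof -
  have \<sigma>_less: "\<sigma> l < d" if "l < d" for l using permutes_in_image[OF \<sigma>] that by auto
  let ?W = "{v \<in> words N d. \<forall>l<d. snd (v ! l) = fst (v ! \<sigma> l)}"
  have "(\<Sum>v \<in> words N d. \<Prod>l<d. of_bool (snd (v ! l) = fst (v ! \<sigma> l)) * g (v ! l))
      = (\<Sum>v \<in> ?W. \<Prod>l<d. of_bool (snd (v ! l) = fst (v ! \<sigma> l)) * g (v ! l))"
    by (rule sum.mono_neutral_right) (auto intro!: prod_zero)
  also have "\<dots> = (\<Sum>f \<in> {..<d} \<rightarrow>\<^sub>E {..<N}. \<Prod>l<d. g (f l, f (\<sigma> l)))"
  proof (rule sum.reindex_bij_witness[where
        j = "\<lambda>v. \<lambda>l\<in>{..<d}. fst (v ! l)" and i = "\<lambda>f. map (\<lambda>l. (f l, f (\<sigma> l))) [0..<d]"])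
    fix v assume v: "v \<in> ?W"
    then have len: "length v = d" and set: "set v \<subseteq> {..<N} \<times> {..<N}" by (auto simp: words_def)
    have eq: "(fst (v ! l), fst (v ! \<sigma> l)) = v ! l" if "l < d" for l
      using v that by (auto simp: prod_eq_iff)
    show "map (\<lambda>l. ((\<lambda>l\<in>{..<d}. fst (v ! l)) l, (\<lambda>l\<in>{..<d}. fst (v ! l)) (\<sigma> l))) [0..<d] = v"
      using len eq \<sigma>_less by (intro nth_equalityI) auto
    have "v ! l \<in> {..<N} \<times> {..<N}" if "l < d" for l
      using nth_mem[of l v] set len that by blast
    then have "fst (v ! l) < N" if "l < d" for l
      using that by (simp add: mem_Times_iff)
    then show "(\<lambda>l\<in>{..<d}. fst (v ! l)) \<in> {..<d} \<rightarrow>\<^sub>E {..<N}" by auto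
    show "(\<Prod>l<d. g ((\<lambda>l\<in>{..<d}. fst (v ! l)) l, (\<lambda>l\<in>{..<d}. fst (v ! l)) (\<sigma> l)))
        = (\<Prod>l<d. of_bool (snd (v ! l) = fst (v ! \<sigma> l)) * g (v ! l))"
      using v eq \<sigma>_less by (intro prod.cong refl) auto
  next
    fix f assume f: "f \<in> {..<d} \<rightarrow>\<^sub>E {..<N}"
    then show "(\<lambda>l\<in>{..<d}. fst (map (\<lambda>l. (f l, f (\<sigma> l))) [0..<d] ! l)) = f"
      by (auto simp: fun_eq_iff PiE_def extensional_def)
    show "map (\<lambda>l. (f l, f (\<sigma> l))) [0..<d] \<in> ?W"
      using f \<sigma>_less by (auto simp: words_def PiE_def Pi_def)
  qed
  finally show ?thesis .
qed

text \<open>Interchanging the sums over words and permutations reassembles the Leibniz formula, with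
  one determinant for every choice f of indices.\<close>

lemma sum_words_alt_trace:
  fixes g :: "pos \<Rightarrow> 'b::comm_ring_1"
  shows "(\<Sum>v \<in> words N d. of_int (alt_trace v) * (\<Prod>p\<leftarrow>v. g p))
    = (\<Sum>f \<in> {..<d} \<rightarrow>\<^sub>E {..<N}. det (mat d d (\<lambda>(l, m). g (f l, f m))))"
proof -
  let ?P = "{\<sigma>. \<sigma> permutes {..<d}}" and ?M = "\<lambda>v \<sigma> l. of_bool (snd (v ! l) = fst (v ! \<sigma> l)) :: 'b"
  have "(\<Sum>v \<in> words N d. of_int (alt_trace v) * (\<Prod>p\<leftarrow>v. g p))
      = (\<Sum>v \<in> words N d. \<Sum>\<sigma>\<in>?P. of_int (sign \<sigma>) * (\<Prod>l<d. ?M v \<sigma> l * g (v ! l)))"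
  proof (intro sum.cong refl)
    fix v assume "v \<in> words N d"
    then have len: "length v = d" by (simp add: words_def)
    have "of_int (alt_trace v) = (\<Sum>\<sigma>\<in>?P. of_int (sign \<sigma>) * (\<Prod>l<d. ?M v \<sigma> l))"
      by (simp add: alt_trace_def len)
    then show "of_int (alt_trace v) * (\<Prod>p\<leftarrow>v. g p)
        = (\<Sum>\<sigma>\<in>?P. of_int (sign \<sigma>) * (\<Prod>l<d. ?M v \<sigma> l * g (v ! l)))"
      by (simp only: prod_list_map_nth len sum_distrib_right prod.distrib mult.assoc)
  qed
  also have "\<dots> = (\<Sum>\<sigma>\<in>?P. of_int (sign \<sigma>) * (\<Sum>f \<in> {..<d} \<rightarrow>\<^sub>E {..<N}. \<Prod>l<d. g (f l, f (\<sigma> l))))"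
    by (subst sum.swap) (simp add: sum_distrib_left[symmetric] sum_words_matching)
  also have "\<dots> = (\<Sum>f \<in> {..<d} \<rightarrow>\<^sub>E {..<N}. \<Sum>\<sigma>\<in>?P. of_int (sign \<sigma>) * (\<Prod>l<d. g (f l, f (\<sigma> l))))"
    unfolding sum_distrib_left by (rule sum.swap)
  also have "\<dots> = (\<Sum>f \<in> {..<d} \<rightarrow>\<^sub>E {..<N}. det (mat d d (\<lambda>(l, m). g (f l, f m))))"
  proof (intro sum.cong refl)
    fix f :: "nat \<Rightarrow> nat"
    have "(\<Prod>l<d. g (f l, f (\<sigma> l))) = (\<Prod>l<d. mat d d (\<lambda>(l, m). g (f l, f m)) $$ (l, \<sigma> l))"
      if "\<sigma> permutes {..<d}" for \<sigma>
      using permutes_in_image[OF that] by (intro prod.cong refl) auto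
    then show "(\<Sum>\<sigma>\<in>?P. of_int (sign \<sigma>) * (\<Prod>l<d. g (f l, f (\<sigma> l))))
        = det (mat d d (\<lambda>(l, m). g (f l, f m)))"
      by (subst det_def') (auto simp: lessThan_atLeast0)
  qed
  finally show ?thesis .
qed

text \<open>Permuting the rows and permuting the columns contribute the same sign, whose square is
  1.\<close>

lemma det_permute_both:
  fixes h :: "nat \<Rightarrow> nat \<Rightarrow> 'b::comm_ring_1"
  assumes \<tau>: "\<tau> permutes {..<d}"
  shows "det (mat d d (\<lambda>(l, m). h (\<tau> l) (\<tau> m))) = det (mat d d (\<lambda>(l, m). h l m))"
proof -
  have \<tau>': "\<tau> permutes {0..<d}" using \<tau> by (simp add: lessThan_atLeast0)
  have \<tau>_less: "\<tau> l < d" if "l < d" for l using permutes_in_image[OF \<tau>] that by auto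
  let ?A = "mat d d (\<lambda>(l, m). h l m)" and ?B = "mat d d (\<lambda>(l, m). h l (\<tau> m))"
  have "mat d d (\<lambda>(l, m). h (\<tau> l) (\<tau> m)) = mat d d (\<lambda>(l, m). ?B $$ (\<tau> l, m))"
    using \<tau>_less by (intro eq_matI) auto
  then have "det (mat d d (\<lambda>(l, m). h (\<tau> l) (\<tau> m))) = signof \<tau> * det ?B"
    using det_permute_rows[OF _ \<tau>', of ?B] by simp
  also have "det ?B = det (transpose_mat ?B)" by (rule det_transpose[symmetric]) auto
  also have "transpose_mat ?B = mat d d (\<lambda>(l, m). transpose_mat ?A $$ (\<tau> l, m))"
    using \<tau>_less by (intro eq_matI) auto
  also have "det \<dots> = signof \<tau> * det (transpose_mat ?A)"
    by (rule det_permute_rows[OF _ \<tau>']) auto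
  also have "det (transpose_mat ?A) = det ?A" by (rule det_transpose) auto
  finally show ?thesis
    by (simp add: mult.assoc[symmetric] of_int_mult[symmetric] del: of_int_mult)
qed

lemma bij_betw_pick:
  assumes "finite I"
  shows "bij_betw (pick I) {..<card I} I"
proof -
  have "pick I ` {..<card I} = I"
  proof
    show "pick I ` {..<card I} \<subseteq> I" by (auto intro: pick_in_set_le)
    have "i \<in> pick I ` {..<card I}" if "i \<in> I" for i
    proof
      show "i = pick I (card {a \<in> I. a < i})" using that by (simp add: pick_card_in_set)
      have "{a \<in> I. a < i} \<subset> I" using that by auto
      then show "card {a \<in> I. a < i} \<in> {..<card I}" using assms by (simp add: psubset_card_mono)
    qed
    then show "I \<subseteq> pick I ` {..<card I}" by blast
  qed
  then show ?thesis by (simp add: bij_betw_def eq_card_imp_inj_on)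
qed

text \<open>The maps onto I are the d! reorderings of the enumeration \<open>pick I\<close>, and
  reordering rows and columns alike does not change the minor.\<close>

lemma sum_det_fun_image:
  fixes g :: "pos \<Rightarrow> 'b::comm_ring_1"
  assumes I: "finite I" "I \<subseteq> {..<N}" "card I = d"
  shows "(\<Sum>f | f \<in> {..<d} \<rightarrow>\<^sub>E {..<N} \<and> f ` {..<d} = I. det (mat d d (\<lambda>(l, m). g (f l, f m))))
    = of_nat (fact d) * det (mat d d (\<lambda>(l, m). g (pick I l, pick I m)))"
proof -
  let ?h = "\<lambda>f. det (mat d d (\<lambda>(l, m). g (f l, f m)))" and ?S = "{..<d}"
  let ?r = "inv_into ?S (pick I)"
  have bij: "bij_betw (pick I) ?S I" using bij_betw_pick[OF I(1)] I(3) by simp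
  have r: "?r (pick I l) = l" if "l < d" for l
    using bij that by (simp add: bij_betw_inv_into_left)
  have p: "pick I (?r i) = i" if "i \<in> I" for i
    using bij that by (rule bij_betw_inv_into_right)
  have "(\<Sum>f | f \<in> ?S \<rightarrow>\<^sub>E {..<N} \<and> f ` ?S = I. ?h f) = (\<Sum>\<tau> | \<tau> permutes ?S. ?h (pick I \<circ> \<tau>))"
  \<comment> \<open>The permutation attached to f sends l to the position of f l in the enumeration
    \<open>pick I\<close>.\<close>
  proof (rule sum.reindex_bij_witness[where
        i = "\<lambda>\<tau>. restrict (pick I \<circ> \<tau>) ?S" and j = "\<lambda>f l. if l < d then ?r (f l) else l"])
    fix f assume f: "f \<in> {f. f \<in> ?S \<rightarrow>\<^sub>E {..<N} \<and> f ` ?S = I}"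
    then have fI: "f l \<in> I" if "l < d" for l using that by auto
    show "restrict (pick I \<circ> (\<lambda>l. if l < d then ?r (f l) else l)) ?S = f"
      using f p fI by (auto simp: fun_eq_iff PiE_def extensional_def)
    have "inj_on f ?S" using f I(3) by (intro eq_card_imp_inj_on) auto
    then have "bij_betw f ?S I" using f by (simp add: bij_betw_def)
    then have "bij_betw (?r \<circ> f) ?S ?S"
      using bij_betw_inv_into[OF bij] by (rule bij_betw_trans)
    then have "bij_betw (\<lambda>l. if l < d then ?r (f l) else l) ?S ?S"
      by (subst bij_betw_cong[where g = "?r \<circ> f"]) auto
    then show "(\<lambda>l. if l < d then ?r (f l) else l) \<in> {\<tau>. \<tau> permutes ?S}"
      by (intro CollectI bij_imp_permutes) auto
    show "?h (pick I \<circ> (\<lambda>l. if l < d then ?r (f l) else l)) = ?h f"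
      using p fI by (intro arg_cong[where f = det] eq_matI) auto
  next
    fix \<tau> assume "\<tau> \<in> {\<tau>. \<tau> permutes ?S}"
    then have \<tau>: "\<tau> permutes ?S" by simp
    have \<tau>_less: "\<tau> l < d" if "l < d" for l using permutes_in_image[OF \<tau>] that by auto
    show "(\<lambda>l. if l < d then ?r (restrict (pick I \<circ> \<tau>) ?S l) else l) = \<tau>"
      using r \<tau>_less permutes_not_in[OF \<tau>] by (auto simp: fun_eq_iff)
    have "restrict (pick I \<circ> \<tau>) ?S ` ?S = pick I ` \<tau> ` ?S" by (simp add: image_comp)
    also have "\<dots> = I" using bij by (simp add: permutes_image[OF \<tau>] bij_betw_def)
    finally show "restrict (pick I \<circ> \<tau>) ?S \<in> {f. f \<in> ?S \<rightarrow>\<^sub>E {..<N} \<and> f ` ?S = I}"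
      using I(2) by (auto simp: PiE_def)
  qed
  also have "\<dots> = (\<Sum>\<tau> | \<tau> permutes ?S. ?h (pick I))"
    using det_permute_both[where h = "\<lambda>l m. g (pick I l, pick I m)"]
    by (intro sum.cong refl) (simp add: comp_def)
  also have "\<dots> = of_nat (fact d) * ?h (pick I)"
    by (simp add: card_permutations)
  finally show ?thesis .
qed

text \<open>The maps are grouped by their image. A map that is not injective produces two equal
  rows, and each d-subset is the image of d! maps with the same minor.\<close>

lemma sum_det_fun:
  fixes g :: "pos \<Rightarrow> 'b::comm_ring_1"
  shows "(\<Sum>f \<in> {..<d} \<rightarrow>\<^sub>E {..<N}. det (mat d d (\<lambda>(l, m). g (f l, f m))))
    = of_nat (fact d) * (\<Sum>I | I \<subseteq> {..<N} \<and> card I = d. det (mat d d (\<lambda>(l, m). g (pick I l, pick I m))))"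
proof -
  let ?h = "\<lambda>f. det (mat d d (\<lambda>(l, m). g (f l, f m)))" and ?S = "{..<d}"
  let ?F = "\<lambda>I. {f \<in> ?S \<rightarrow>\<^sub>E {..<N}. f ` ?S = I}"
  have "(\<Sum>f \<in> ?S \<rightarrow>\<^sub>E {..<N}. ?h f) = (\<Sum>I \<in> Pow {..<N}. sum ?h (?F I))"
    by (rule sum.group[symmetric]) (auto intro: finite_PiE)
  also have "\<dots> = (\<Sum>I | I \<subseteq> {..<N} \<and> card I = d. sum ?h (?F I))"
  proof (rule sum.mono_neutral_right)
    show "\<forall>I \<in> Pow {..<N} - {I. I \<subseteq> {..<N} \<and> card I = d}. sum ?h (?F I) = 0"
    proof (intro ballI sum.neutral)
      fix I f assume I: "I \<in> Pow {..<N} - {I. I \<subseteq> {..<N} \<and> card I = d}" and f: "f \<in> ?F I"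
      then have "\<not> inj_on f ?S" using card_image[of f ?S] by auto
      then obtain a b where ab: "a < d" "b < d" "a \<noteq> b" "f a = f b" by (auto simp: inj_on_def)
      show "?h f = 0"
        by (rule det_identical_rows[of _ d a b]) (use ab in \<open>auto intro: eq_vecI\<close>)
    qed
  qed auto
  also have "\<dots> = (\<Sum>I | I \<subseteq> {..<N} \<and> card I = d. of_nat (fact d) * ?h (pick I))"
    using sum_det_fun_image[of _ N d g] finite_subset[OF _ finite_lessThan[of N]]
    by (intro sum.cong refl) (auto simp: Collect_conj_eq)
  finally show ?thesis by (simp add: sum_distrib_left)
qed

text \<open>Every principal minor occurs once for each of the d! orderings of its index set. Placing
  d! on the left keeps the identity free of division in the symmetric algebra.\<close>

lemma fact_Delta:
  "of_nat (fact d) * Delta n d = (\<Sum>v \<in> words (2*n) d.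
     of_int (alt_trace v) * (\<Prod>y\<leftarrow>map (case_prod (F_elt n)) v. sym_of (2*n) y) :: 'a::field_char_0 sym_alg)"
proof -
  let ?N = "2*n" and ?g = "\<lambda>p. sym_of (2*n) (case_prod (F_elt n) p) :: 'a sym_alg"
  have "submatrix (F_matrix n) I I = mat d d (\<lambda>(l, m). ?g (pick I l, pick I m))"
    if I: "I \<subseteq> {..<?N}" "card I = d" for I
  proof -
    have eq: "{i. i < ?N \<and> i \<in> I} = I" using I by auto
    have "pick I l < ?N" if "l < d" for l
      using pick_in_set_le[of l I] that I by auto
    then show ?thesis
      unfolding submatrix_def by (intro eq_matI) (auto simp: F_matrix_def eq I)
  qed
  then have Delta: "Delta n d = (\<Sum>I | I \<subseteq> {..<?N} \<and> card I = d. det (mat d d (\<lambda>(l, m). ?g (pick I l, pick I m))))"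
    unfolding Delta_def by (intro sum.cong refl) auto
  have "(\<Sum>v \<in> words ?N d. of_int (alt_trace v) * (\<Prod>p\<leftarrow>v. ?g p)) = of_nat (fact d) * Delta n d"
    unfolding sum_words_alt_trace[where g = ?g] Delta by (rule sum_det_fun[where g = ?g])
  then show ?thesis by (simp only: map_map comp_def)
qed

section \<open>Passage from minors to symmetric tensors\<close>

lemma symmetrisation_uminus: "symmetrisation N (- P) w = - symmetrisation N P w"
  using symmetrisation_add[of N P "- P" w] by (simp add: eq_neg_iff_add_eq_0 add.commute)

lemma symmetrisation_of_nat: "symmetrisation N (of_nat m * P) w = of_nat m * symmetrisation N P w"
  by (induction m) (simp_all add: distrib_right symmetrisation_add)

lemma symmetrisation_of_int: "symmetrisation N (of_int c * P) w = of_int c * symmetrisation N P w"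
  by (cases c rule: int_cases2) (simp_all add: symmetrisation_uminus symmetrisation_of_nat)

lemma sum_words_permute:
  assumes \<tau>: "\<tau> permutes {..<d}"
  shows "(\<Sum>v \<in> words N d. f (permute_list \<tau> v)) = (\<Sum>v \<in> words N d. f v)"
proof (rule sum.reindex_bij_witness[where
      i = "permute_list (inv_into UNIV \<tau>)" and j = "permute_list \<tau>"])
  have i: "inv_into UNIV \<tau> permutes {..<d}" using \<tau> by (rule permutes_inv)
  fix v :: "pos list" assume v: "v \<in> words N d"
  then have len: "length v = d" by (simp add: words_def)
  show "permute_list (inv_into UNIV \<tau>) (permute_list \<tau> v) = v"
    using permute_list_compose[of "inv_into UNIV \<tau>" v \<tau>] permutes_inv_o(1)[OF \<tau>] i len by simp
  show "permute_list \<tau> (permute_list (inv_into UNIV \<tau>) v) = v"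
    using permute_list_compose[of \<tau> v "inv_into UNIV \<tau>"] permutes_inv_o(2)[OF \<tau>] \<tau> len by simp
  show "permute_list \<tau> v \<in> words N d" "permute_list (inv_into UNIV \<tau>) v \<in> words N d"
    using v \<tau> i len by (auto simp: words_def)
qed simp

text \<open>The coefficients \<open>alt_trace\<close> are already invariant under permutations of
  the word, so symmetrising is an average of d! equal sums. Only the factor 1/d! coming from
  \<open>fact_Delta\<close> remains.\<close>

lemma symmetrisation_Delta:
  "symmetrisation (2*n) (Delta n d :: 'a::field_char_0 sym_alg) w
    = (\<Sum>v \<in> words (2*n) d. of_int (alt_trace v) * pure_tensor (2*n) (map (case_prod (F_elt n)) v) w) / fact d"
proof -
  let ?N = "2*n" and ?P = "{\<tau>. \<tau> permutes {..<d}}" and ?F = "map (case_prod (F_elt n)) :: pos list \<Rightarrow> 'a mat list"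
  let ?T = "\<Sum>v \<in> words ?N d. of_int (alt_trace v) * pure_tensor ?N (?F v) w"
  have "fact d * symmetrisation ?N (Delta n d) w = symmetrisation ?N (of_nat (fact d) * Delta n d) w"
    unfolding symmetrisation_of_nat by simp
  also have "\<dots> = (\<Sum>v \<in> words ?N d. of_int (alt_trace v) * sym_tensor ?N (?F v) w)"
    by (simp only: fact_Delta symmetrisation_sum symmetrisation_of_int symmetrisation_prod)
  also have "\<dots> = (\<Sum>v \<in> words ?N d. \<Sum>\<tau>\<in>?P.
      of_int (alt_trace (permute_list \<tau> v)) * pure_tensor ?N (?F (permute_list \<tau> v)) w / fact d)"
  proof (intro sum.cong refl)
    fix v assume "v \<in> words ?N d"
    then have len: "length v = d" by (simp add: words_def)
    have "pure_tensor ?N (permute_list \<tau> (?F v)) w = pure_tensor ?N (?F (permute_list \<tau> v)) w"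
      if "\<tau> \<in> ?P" for \<tau> using that len by (simp add: permute_list_map)
    then have "sym_tensor ?N (?F v) w = (\<Sum>\<tau>\<in>?P. pure_tensor ?N (?F (permute_list \<tau> v)) w) / fact d"
      by (simp add: sym_tensor_def len)
    then show "of_int (alt_trace v) * sym_tensor ?N (?F v) w = (\<Sum>\<tau>\<in>?P.
        of_int (alt_trace (permute_list \<tau> v)) * pure_tensor ?N (?F (permute_list \<tau> v)) w / fact d)"
      by (simp add: sum_distrib_left sum_divide_distrib alt_trace_permute len)
  qed
  also have "\<dots> = (\<Sum>\<tau>\<in>?P. (\<Sum>v \<in> words ?N d.
      of_int (alt_trace v) * pure_tensor ?N (?F v) w / fact d))"
    by (subst sum.swap, rule sum.cong[OF refl], rule sum_words_permute) simp
  also have "\<dots> = ?T"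
    by (simp add: card_permutations sum_divide_distrib[symmetric])
  finally show ?thesis by (simp add: field_simps)
qed

subsection \<open>The maps m as Berezin integrals\<close>

text \<open>For fixed (a, b) the entry of F_p is supported on p = (a, b) and p = (b', a'), and the
  contributions add when the two positions coincide.\<close>

lemma omega_expand:
  assumes ab: "a < 2*n" "b < 2*n"
  shows "omega n (a, b) = (\<Sum>p \<in> {..<2*n} \<times> {..<2*n}.
    gen p * scalar (case_prod (F_elt n) p $$ (a, b) :: 'a::field_char_0))"
proof -
  let ?S = "{..<2*n} \<times> {..<2*n}" and ?q = "(prime_idx n b, prime_idx n a)"
  let ?c = "- (rsgn n a * rsgn n b) :: 'a minor_alg"
  have "gen p * scalar (case_prod (F_elt n) p $$ (a, b) :: 'a)
      = (if p = (a, b) then gen p else 0) + (if p = ?q then ?c * gen p else 0)" if pS: "p \<in> ?S" for p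
  proof -
    obtain i j where p: "p = (i, j)" and ij: "i < 2*n" "j < 2*n" using pS by auto
    have "scalar (F_elt n i j $$ (a, b) :: 'a) = (if p = (a, b) then 1 else 0) + ?c * (if p = ?q then 1 else 0)"
    proof -
      have split: "scalar ((if P then 1 else 0) - c * (if Q then 1 else 0))
          = (if P then 1 else 0) + - scalar c * (if Q then 1 else 0)" for P Q and c :: 'a
        by (cases P; cases Q) (simp_all add: scalar_diff scalar_uminus)
      have c: "?c = - scalar (eps n a * eps n b)" by (simp add: rsgn_def scalar_mult)
      show ?thesis unfolding F_elt_index[OF ab ij] p prod.inject c by (rule split)
    qed
    then have entry: "scalar (case_prod (F_elt n) p $$ (a, b) :: 'a)
        = (if p = (a, b) then 1 else 0) + ?c * (if p = ?q then 1 else 0)"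
      by (simp only: p case_prod_conv)
    have "g * ((if P then 1 else 0) + c * (if Q then 1 else 0)) = (if P then g else 0) + (if Q then c * g else 0)"
      for P Q and g c :: "'a minor_alg"
      by (cases P; cases Q) (simp_all add: algebra_simps)
    then show ?thesis unfolding entry .
  qed
  then have "(\<Sum>p\<in>?S. gen p * scalar (case_prod (F_elt n) p $$ (a, b) :: 'a))
      = (\<Sum>p\<in>?S. (if p = (a, b) then gen p else 0) + (if p = ?q then ?c * gen p else 0))"
    by (rule sum.cong[OF refl])
  also have "\<dots> = omega n (a, b)"
    using ab by (simp add: sum.distrib prime_idx omega_def dual_gen_def)
  finally show ?thesis ..
qed

lemma bracket_power_carrier [simp]:
  "X \<in> carrier_mat (2*n) (2*n) \<Longrightarrow> (bracket (Omega n) ^^ q) X \<in> carrier_mat (2*n) (2*n)"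
  by (induction q) auto

text \<open>The generators commute with everything, so they are collected in front while the
  commutators act on matrices over the ground field.\<close>

lemma bracket_power_index:
  fixes x :: "'a::field_char_0 mat"
  assumes x: "x \<in> carrier_mat (2*n) (2*n)" and "a < 2*n" "b < 2*n"
  shows "(bracket (Omega n) ^^ q) (map_mat scalar x) $$ (a, b)
    = (\<Sum>u \<in> words (2*n) q. (\<Prod>p\<leftarrow>u. gen p) * scalar (foldr ad (map (case_prod (F_elt n)) u) x $$ (a, b)))"
  using assms(2,3)
proof (induction q arbitrary: a b)
  case 0
  then show ?case using x by (simp add: words_0)
next
  case (Suc q)
  let ?N = "2*n" and ?F = "case_prod (F_elt n) :: pos \<Rightarrow> 'a mat"
  let ?A = "\<lambda>u. foldr ad (map ?F u) x" and ?G = "\<lambda>u. \<Prod>p\<leftarrow>u. gen p :: 'a minor_alg"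
  define Y where "Y = (bracket (Omega n) ^^ q) (map_mat scalar x)"
  have Y: "Y \<in> carrier_mat ?N ?N" using x by (simp add: Y_def)
  have F: "?F p \<in> carrier_mat ?N ?N" for p by (cases p) simp
  then have A: "?A u \<in> carrier_mat ?N ?N" for u
    using x by (intro foldr_ad_carrier) auto
  have Y_index: "Y $$ (i, j) = (\<Sum>u \<in> words ?N q. ?G u * scalar (?A u $$ (i, j)))"
    if "i < ?N" "j < ?N" for i j
    unfolding Y_def using that by (rule Suc.IH)
  have prod: "omega n (i, k) * Y $$ (j, l) = (\<Sum>p \<in> {..<?N} \<times> {..<?N}. \<Sum>u \<in> words ?N q.
      ?G (p # u) * (scalar (?F p $$ (i, k)) * scalar (?A u $$ (j, l))))"
    if "i < ?N" "k < ?N" "j < ?N" "l < ?N" for i k j l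
    unfolding Y_index[OF that(3,4)] omega_expand[OF that(1,2)] sum_product
    by (intro sum.cong refl) (simp add: ac_simps)
  have "(bracket (Omega n) ^^ Suc q) (map_mat scalar x) $$ (a, b) = bracket (Omega n) Y $$ (a, b)"
    by (simp add: Y_def)
  also have "\<dots> = (\<Sum>k<?N. omega n (a, k) * Y $$ (k, b) - omega n (k, b) * Y $$ (a, k))"
    using Suc.prems by (subst bracket_index[OF Omega_carrier Y]) (auto simp: Omega_index mult.commute intro!: sum.cong)
  also have "\<dots> = (\<Sum>k<?N. \<Sum>p \<in> {..<?N} \<times> {..<?N}. \<Sum>u \<in> words ?N q.
      ?G (p # u) * scalar (?F p $$ (a, k) * ?A u $$ (k, b) - ?F p $$ (k, b) * ?A u $$ (a, k)))"
    using Suc.prems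
    by (intro sum.cong refl)
       (simp add: prod sum_subtractf[symmetric] scalar_diff scalar_mult right_diff_distrib del: list.map prod_list.Cons)
  also have "\<dots> = (\<Sum>p \<in> {..<?N} \<times> {..<?N}. \<Sum>u \<in> words ?N q. \<Sum>k<?N.
      ?G (p # u) * scalar (?F p $$ (a, k) * ?A u $$ (k, b) - ?F p $$ (k, b) * ?A u $$ (a, k)))"
    by (subst sum.swap, rule sum.cong[OF refl], rule sum.swap)
  also have "\<dots> = (\<Sum>p \<in> {..<?N} \<times> {..<?N}. \<Sum>u \<in> words ?N q. ?G (p # u) * scalar (?A (p # u) $$ (a, b)))"
  proof (intro sum.cong refl)
    fix p u
    have "ad (?F p) (?A u) $$ (a, b)
        = (\<Sum>k<?N. ?F p $$ (a, k) * ?A u $$ (k, b) - ?F p $$ (k, b) * ?A u $$ (a, k))"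
      unfolding ad_index[OF F A Suc.prems] by (intro sum.cong refl) (simp only: mult.commute)
    then show "(\<Sum>k<?N. ?G (p # u) * scalar (?F p $$ (a, k) * ?A u $$ (k, b) - ?F p $$ (k, b) * ?A u $$ (a, k)))
        = ?G (p # u) * scalar (?A (p # u) $$ (a, b))"
      by (simp add: scalar_sum sum_distrib_left)
  qed
  finally show ?case by (simp add: sum_words_Suc)
qed

lemma omegas_expand:
  assumes "set w \<subseteq> {..<2*n} \<times> {..<2*n}"
  shows "(\<Prod>q\<leftarrow>w. omega n q) = (\<Sum>v \<in> words (2*n) (length w). (\<Prod>p\<leftarrow>v. gen p)
    * scalar (\<Prod>l<length w. case_prod (F_elt n) (v ! l) $$ (w ! l) :: 'a::field_char_0))"
  using assms
proof (induction w)
  case Nil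
  then show ?case by (simp add: words_0)
next
  case (Cons q w)
  obtain a b where q: "q = (a, b)" and ab: "a < 2*n" "b < 2*n" using Cons.prems by auto
  have IH: "(\<Prod>q\<leftarrow>w. omega n q) = (\<Sum>v \<in> words (2*n) (length w). (\<Prod>p\<leftarrow>v. gen p)
    * scalar (\<Prod>l<length w. case_prod (F_elt n) (v ! l) $$ (w ! l) :: 'a))"
    using Cons by auto
  have "(\<Prod>q\<leftarrow>q # w. omega n q) = omega n (a, b) * (\<Prod>q\<leftarrow>w. omega n q)" by (simp add: q)
  also have "\<dots> = (\<Sum>p \<in> {..<2*n} \<times> {..<2*n}. \<Sum>v \<in> words (2*n) (length w).
      gen p * (\<Prod>p\<leftarrow>v. gen p) * (scalar (case_prod (F_elt n) p $$ (a, b))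
      * scalar (\<Prod>l<length w. case_prod (F_elt n) (v ! l) $$ (w ! l) :: 'a)))"
    unfolding omega_expand[OF ab] IH sum_product by (intro sum.cong refl) (simp only: ac_simps)
  finally show ?case
    by (simp add: sum_words_Suc q prod.lessThan_Suc_shift scalar_mult del: prod.lessThan_Suc)
qed

text \<open>Integrating the product of the two expansions turns the monomial of \<open>u @ v\<close>
  into \<open>alt_trace (u @ v)\<close>, the coefficient occurring in the symmetrisation of
  \<Delta>.\<close>

lemma berezin_bracket_power:
  fixes x :: "'a::field_char_0 mat"
  assumes x: "x \<in> carrier_mat (2*n) (2*n)" and ab: "a < 2*n" "b < 2*n" and w: "w \<in> words (2*n) m"
  shows "berezin ((bracket (Omega n) ^^ q) (map_mat scalar x) $$ (a, b) * (\<Prod>p\<leftarrow>w. omega n p))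
    = (\<Sum>u \<in> words (2*n) q. \<Sum>v \<in> words (2*n) m. of_int (alt_trace (u @ v))
        * (pure_tensor (2*n) (map (case_prod (F_elt n)) v) w
        * foldr ad (map (case_prod (F_elt n)) u) x $$ (a, b)))"
proof -
  let ?N = "2*n" and ?F = "case_prod (F_elt n) :: pos \<Rightarrow> 'a mat"
  have len: "length w = m" and set: "set w \<subseteq> {..<?N} \<times> {..<?N}" using w by (auto simp: words_def)
  have monomials: "berezin ((\<Prod>p\<leftarrow>u. gen p) * scalar c * ((\<Prod>p\<leftarrow>v. gen p) * scalar d))
      = of_int (alt_trace (u @ v)) * (d * c)" for u v and c d :: 'a
  proof -
    have "(\<Prod>p\<leftarrow>u. gen p) * scalar c * ((\<Prod>p\<leftarrow>v. gen p) * scalar d)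
        = scalar (d * c) * (\<Prod>p\<leftarrow>u @ v. gen p)"
      by (simp add: scalar_mult ac_simps)
    then show ?thesis by (simp only: berezin_scalar berezin_gens mult.commute)
  qed
  have "pure_tensor ?N (map ?F v) w = (\<Prod>l<m. ?F (v ! l) $$ (w ! l))" if "v \<in> words ?N m" for v
    using that w by (simp add: pure_tensor_def words_def)
  then show ?thesis
    unfolding bracket_power_index[OF x ab] omegas_expand[OF set] len sum_product berezin_sum monomials
    by (intro sum.cong refl) simp
qed

lemma sum_words_append:
  "(\<Sum>v \<in> words N (q + m). f v) = (\<Sum>u \<in> words N q. \<Sum>v \<in> words N m. f (u @ v))"
  by (induction q arbitrary: f) (simp_all add: words_0 sum_words_Suc)

text \<open>The bridge between tensors and integrals: the first q tensor factors become factors ad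
  \<Omega>, and reading off the coefficient at w in the other m gives the entries of \<Omega> at the
  letters of w.\<close>

lemma ad_contract_Delta:
  fixes x :: "'a::field_char_0 mat"
  assumes x: "x \<in> sp n" and ab: "a < 2*n" "b < 2*n"
  shows "ad_contract n q (symmetrisation (2*n) (Delta n (q + m))) w x $$ (a, b)
    = (if w \<in> words (2*n) m
       then berezin ((bracket (Omega n) ^^ q) (map_mat scalar x) $$ (a, b) * (\<Prod>p\<leftarrow>w. omega n p)) / fact (q + m)
       else 0)"
proof -
  let ?N = "2*n" and ?F = "map (case_prod (F_elt n)) :: pos list \<Rightarrow> 'a mat list"
  have xc: "x \<in> carrier_mat ?N ?N" using x by (rule sp_carrier)
  have pure: "ad_contract n q (pure_tensor ?N (?F (u @ v))) w x $$ (a, b)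
      = pure_tensor ?N (?F v) w * foldr ad (?F u) x $$ (a, b)"
    if u: "u \<in> words ?N q" for u v
  proof -
    have len: "length u = q" using u by (simp add: words_def)
    have carrier: "set (?F t) \<subseteq> carrier_mat ?N ?N" for t by auto
    have "ad_contract n q (pure_tensor ?N (?F (u @ v))) w
        = (\<lambda>x \<in> sp n. pure_tensor ?N (drop q (?F (u @ v))) w \<cdot>\<^sub>m foldr ad (take q (?F (u @ v))) x)"
      by (rule ad_contract_pure_tensor[OF carrier]) (simp add: len)
    moreover have "foldr ad (?F u) x \<in> carrier_mat ?N ?N" using carrier xc by (rule foldr_ad_carrier)
    ultimately show ?thesis using ab x by (simp add: len)
  qed
  have "ad_contract n q (symmetrisation ?N (Delta n (q + m))) w x $$ (a, b)
      = (\<Sum>v \<in> words ?N (q + m). of_int (alt_trace v) * ad_contract n q (pure_tensor ?N (?F v)) w x $$ (a, b))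
        / fact (q + m)"
    using x ab
    by (simp add: ad_contract_def symmetrisation_Delta sum_divide_distrib sum_distrib_left sum_distrib_right mult.assoc)
       (subst sum.swap, simp)
  also have "\<dots> = (\<Sum>u \<in> words ?N q. \<Sum>v \<in> words ?N m. of_int (alt_trace (u @ v))
      * (pure_tensor ?N (?F v) w * foldr ad (?F u) x $$ (a, b))) / fact (q + m)"
    unfolding sum_words_append by (intro arg_cong2[where f = "(/)"] sum.cong refl) (simp add: pure del: map_append)
  also have "\<dots> = (if w \<in> words ?N m
       then berezin ((bracket (Omega n) ^^ q) (map_mat scalar x) $$ (a, b) * (\<Prod>p\<leftarrow>w. omega n p)) / fact (q + m)
       else 0)"
  proof (cases "w \<in> words ?N m")
    case True
    then show ?thesis by (simp add: berezin_bracket_power[OF xc ab True])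
  next
    case False
    then have "pure_tensor ?N (?F v) w = 0" if "v \<in> words ?N m" for v
      using that by (auto simp: pure_tensor_def words_def)
    with False show ?thesis by simp
  qed
  finally show ?thesis .
qed

text \<open>The entries of the q-th bracket power are combinations of products of q entries of
  \<Omega>. The induction moves one such entry at a time into \<open>ps\<close>, which keeps
  \<open>q + length ps\<close> constant.\<close>

lemma berezin_casimir_bracket_power:
  fixes x :: "'a::field_char_0 mat"
  assumes x: "x \<in> carrier_mat (2*n) (2*n)" and "a < 2*n" "b < 2*n" "set ps \<subseteq> {..<2*n} \<times> {..<2*n}"
  shows "berezin (casimir n * ((bracket (Omega n) ^^ q) (map_mat scalar x) $$ (a, b) * (\<Prod>p\<leftarrow>ps. omega n p)))
    = (of_nat (2*n) - of_nat (q + length ps)) * (of_nat (2*n) - of_nat (q + length ps) + 1)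
      * berezin ((bracket (Omega n) ^^ q) (map_mat scalar x) $$ (a, b) * (\<Prod>p\<leftarrow>ps. omega n p))"
  using assms(2-4)
proof (induction q arbitrary: a b ps)
  case 0
  have "berezin (casimir n * (scalar c * f)) = c * berezin (casimir n * f)" for c and f :: "'a minor_alg"
    unfolding mult.left_commute[of "casimir n"] by (rule berezin_scalar)
  then show ?case using 0 x by (simp add: berezin_scalar berezin_casimir)
next
  case (Suc q)
  let ?N = "2*n"
  define Y where "Y = (bracket (Omega n) ^^ q) (map_mat scalar x)"
  define c where "c = (of_nat ?N - of_nat (Suc q + length ps)) * (of_nat ?N - of_nat (Suc q + length ps) + 1 :: 'a)"
  let ?O = "\<lambda>ps. \<Prod>p\<leftarrow>ps. omega n p :: 'a minor_alg"
  have Y: "Y \<in> carrier_mat ?N ?N" using x by (simp add: Y_def)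
  have IH: "berezin (casimir n * (Y $$ (i, j) * ?O (p # ps))) = c * berezin (Y $$ (i, j) * ?O (p # ps))"
    if "i < ?N" "j < ?N" "p \<in> {..<?N} \<times> {..<?N}" for i j p
    using Suc.IH[of i j "p # ps"] that Suc.prems by (simp add: Y_def c_def)
  have expand: "(bracket (Omega n) ^^ Suc q) (map_mat scalar x) $$ (a, b) * ?O ps
      = (\<Sum>k<?N. Y $$ (k, b) * ?O ((a, k) # ps) - Y $$ (a, k) * ?O ((k, b) # ps))"
  proof -
    have "(bracket (Omega n) ^^ Suc q) (map_mat scalar x) $$ (a, b) = bracket (Omega n) Y $$ (a, b)"
      by (simp add: Y_def)
    also have "\<dots> = (\<Sum>k<?N. omega n (a, k) * Y $$ (k, b) - Y $$ (a, k) * omega n (k, b))"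
      using Suc.prems by (subst bracket_index[OF Omega_carrier Y]) (auto simp: Omega_index intro!: sum.cong)
    finally have E: "(bracket (Omega n) ^^ Suc q) (map_mat scalar x) $$ (a, b)
      = (\<Sum>k<?N. omega n (a, k) * Y $$ (k, b) - Y $$ (a, k) * omega n (k, b))" .
    show ?thesis
      unfolding E sum_distrib_right by (intro sum.cong refl) (simp add: algebra_simps)
  qed
  show ?case
    unfolding expand sum_distrib_left berezin_sum c_def[symmetric]
    using Suc.prems
    by (intro sum.cong refl)
       (simp add: right_diff_distrib berezin_diff IH del: list.map prod_list.Cons)
qed

section \<open>Removing two factors ad \<Omega> at a time\<close>

lemma bracket_power_smult:
  assumes "X \<in> carrier_mat (2*n) (2*n)"
  shows "(bracket (Omega n) ^^ q) (c \<cdot>\<^sub>m X) = c \<cdot>\<^sub>m (bracket (Omega n) ^^ q) X"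
  using assms
proof (induction q)
  case (Suc q)
  then show ?case by (simp add: bracket_smult[of _ "2*n"])
qed simp

text \<open>The cubic relation replaces the three innermost brackets by one. The Casimir element
  passes through the outer brackets by linearity and then meets \<open>q + 1 + length ps\<close>
  entries of \<Omega>.\<close>

lemma berezin_bracket_step:
  fixes x :: "'a::field_char_0 mat"
  assumes x: "x \<in> sp n" and ab: "a < 2*n" "b < 2*n" and ps: "set ps \<subseteq> {..<2*n} \<times> {..<2*n}"
  shows "berezin ((bracket (Omega n) ^^ (q + 3)) (map_mat scalar x) $$ (a, b) * (\<Prod>p\<leftarrow>ps. omega n p))
    = (of_nat (2*n) - of_nat (q + 1 + length ps)) * (of_nat (2*n) - of_nat (q + 1 + length ps) + 1)
      * berezin ((bracket (Omega n) ^^ (q + 1)) (map_mat scalar x) $$ (a, b) * (\<Prod>p\<leftarrow>ps. omega n p))"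
proof -
  let ?f = "bracket (Omega n)" and ?X = "map_mat scalar x"
  have X: "?X \<in> carrier_mat (2*n) (2*n)" using sp_carrier[OF x] by simp
  have "(?f ^^ (q + 3)) ?X = (?f ^^ q) ((?f ^^ 3) ?X)"
    by (simp only: funpow_add comp_apply)
  also have "(?f ^^ 3) ?X = ?f (?f (?f ?X))"
    by (simp add: numeral_3_eq_3)
  also have "(?f ^^ q) \<dots> = casimir n \<cdot>\<^sub>m (?f ^^ q) (?f ?X)"
    using X by (simp add: Omega_bracket_cube[OF x] bracket_power_smult)
  also have "(?f ^^ q) (?f ?X) = (?f ^^ (q + 1)) ?X"
    by (simp add: funpow_swap1)
  finally have "(?f ^^ (q + 3)) ?X $$ (a, b) = casimir n * (?f ^^ (q + 1)) ?X $$ (a, b)"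
    using ab carrier_matD[OF bracket_power_carrier[OF X, of "q + 1"]] by simp
  then show ?thesis
    using berezin_casimir_bracket_power[OF sp_carrier[OF x] ab ps, of "q + 1"] by (simp add: mult.assoc)
qed

text \<open>Here e is 2n minus the number m + 2r + 1 of entries of \<Omega>. Removing two factors
  multiplies by (e + 2) (e + 3) and raises e by 2, so the factorials telescope.\<close>

lemma berezin_bracket_odd_power:
  fixes x :: "'a::field_char_0 mat"
  assumes x: "x \<in> sp n" and ab: "a < 2*n" "b < 2*n" and w: "w \<in> words (2*n) m"
    and e: "2*n = e + m + 2*r + 1"
  shows "fact (e + 1) * berezin ((bracket (Omega n) ^^ (2*r + 1)) (map_mat scalar x) $$ (a, b) * (\<Prod>p\<leftarrow>w. omega n p))
    = fact (2*n - m) * berezin (bracket (Omega n) (map_mat scalar x) $$ (a, b) * (\<Prod>p\<leftarrow>w. omega n p))"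
  using e
proof (induction r arbitrary: e)
  case 0
  then show ?case by simp
next
  case (Suc r)
  let ?b = "\<lambda>q. berezin ((bracket (Omega n) ^^ q) (map_mat scalar x) $$ (a, b) * (\<Prod>p\<leftarrow>w. omega n p))"
  have w': "set w \<subseteq> {..<2*n} \<times> {..<2*n}" and len: "length w = m" using w by (auto simp: words_def)
  have diff: "of_nat (2*n) - of_nat (2*r + 1 + m) = (of_nat (e + 2) :: 'a)"
    unfolding Suc.prems by simp
  have "?b (2*r + 3) = of_nat (e + 2) * (of_nat (e + 2) + 1) * ?b (2*r + 1)"
    using berezin_bracket_step[OF x ab w', of "2*r"] unfolding len diff .
  then have "fact (e + 1) * ?b (2 * Suc r + 1) = fact ((e + 2) + 1) * ?b (2*r + 1)"
    by (simp add: numeral_3_eq_3 algebra_simps)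
  also have "\<dots> = fact (2*n - m) * berezin (bracket (Omega n) (map_mat scalar x) $$ (a, b) * (\<Prod>p\<leftarrow>w. omega n p))"
    by (rule Suc.IH) (use Suc.prems in simp)
  finally show ?case .
qed

theorem proposition4p3:
  fixes n k r :: nat
  assumes "r < k" and "k \<le> n"
  shows "m_map n (2*r + 1) (Delta n (2*k) :: 'a::field_char_0 sym_alg)
    = op_scale n
        (fact (2*k - 2*r) * fact (2*r) / fact (2*k)
          * of_nat ((2*n - 2*k + 2*r + 1) choose (2*r)))
        (ad_embed n (Delta n (2*k - 2*r)))"
proof
  fix w
  \<comment> \<open>\<open>?m\<close> counts the tensor factors left uncontracted, the same number
    on both sides; \<open>?e\<close> is the e of \<open>berezin_bracket_odd_power\<close>.\<close>
  let ?N = "2*n" and ?m = "2*k - 2*r - 1" and ?e = "2*n - 2*k"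
  let ?c = "fact (2*k - 2*r) * fact (2*r) / fact (2*k)
    * of_nat ((2*n - 2*k + 2*r + 1) choose (2*r)) :: 'a"
  have k: "2*k = 2*r + 1 + ?m" and kr: "2*k - 2*r = 1 + ?m" using assms by auto
  let ?L = "ad_contract n (2*r + 1) (symmetrisation ?N (Delta n (2*k) :: 'a sym_alg))"
  let ?R = "ad_contract n 1 (symmetrisation ?N (Delta n (2*k - 2*r) :: 'a sym_alg))"
  have entry: "?L w x $$ (a, b) = ?c * ?R w x $$ (a, b)"
    if x: "x \<in> sp n" and ab: "a < ?N" "b < ?N" for x a b
  proof (cases "w \<in> words ?N ?m")
    case True
    let ?b = "\<lambda>q. berezin ((bracket (Omega n) ^^ q) (map_mat scalar x) $$ (a, b) * (\<Prod>p\<leftarrow>w. omega n p))"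
    have L: "?L w x $$ (a, b) = ?b (2*r + 1) / fact (2*k)"
      using ad_contract_Delta[OF x ab, of "2*r + 1" ?m w] True k by simp
    have R: "?R w x $$ (a, b) = ?b 1 / fact (2*k - 2*r)"
      using ad_contract_Delta[OF x ab, of 1 ?m w] True kr by simp
    have "fact (?e + 1) * ?b (2*r + 1) = fact (?N - ?m) * ?b 1"
      using berezin_bracket_odd_power[OF x ab True, of ?e r] assms by simp
    also have "?N - ?m = 2*n - 2*k + 2*r + 1" using assms by simp
    \<comment> \<open>The quotient of (2n - 2k + 2r + 1)! by (2n - 2k + 1)! is (2r)! times the
      binomial coefficient of the statement.\<close>
    also have "fact (2*n - 2*k + 2*r + 1)
        = fact (2*r) * fact (?e + 1) * (of_nat ((2*n - 2*k + 2*r + 1) choose (2*r)) :: 'a)"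
    proof -
      have "fact (2*r) * fact (?e + 1) * ((2*n - 2*k + 2*r + 1) choose (2*r)) = fact (2*n - 2*k + 2*r + 1)"
        using binomial_fact_lemma[of "2*r" "2*n - 2*k + 2*r + 1"] by simp
      from this[THEN arg_cong[where f = "of_nat :: nat \<Rightarrow> 'a"]] show ?thesis
        by (simp only: of_nat_mult of_nat_fact)
    qed
    finally have "fact (?e + 1) * ?b (2*r + 1) = fact (?e + 1)
        * (fact (2*r) * of_nat ((2*n - 2*k + 2*r + 1) choose (2*r)) * ?b 1)"
      by (simp only: ac_simps)
    then have "?b (2*r + 1) = fact (2*r) * of_nat ((2*n - 2*k + 2*r + 1) choose (2*r)) * ?b 1"
      by (simp only: mult_left_cancel[OF fact_nonzero])
    then show ?thesis unfolding L R by simp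
  next
    \<comment> \<open>At words of the wrong length or range both coefficients are zero.\<close>
    case False
    then show ?thesis
      using ad_contract_Delta[OF x ab, of "2*r + 1" ?m w] ad_contract_Delta[OF x ab, of 1 ?m w] k kr by simp
  qed
  have dim: "ad_contract n q T w x \<in> carrier_mat ?N ?N" if "x \<in> sp n" for q T and x :: "'a mat"
    using that by (simp add: ad_contract_def)
  have "?L w x = ?c \<cdot>\<^sub>m ?R w x" if "x \<in> sp n" for x
    using entry[OF that] dim[OF that, THEN carrier_matD(1)] dim[OF that, THEN carrier_matD(2)]
    by (intro eq_matI) auto
  \<comment> \<open>Outside sp(2n) both restricted functions take the default value
    \<open>undefined\<close>.\<close>
  moreover have "?L w x = undefined" if "x \<notin> sp n" for x
    using that by (simp add: ad_contract_def)
  ultimately show "m_map n (2*r + 1) (Delta n (2*k)) w = op_scale n ?c (ad_embed n (Delta n (2*k - 2*r))) w"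
    by (auto simp: m_map_def ad_embed_def op_scale_def fun_eq_iff)
qed

end
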